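(* Let $\gamma$ be a simple closed plane curve with curvature at most $1$ and diameter at least $4$. Then there are two disjoint open disks of radius $1$ inside $\gamma$, i.e. both contained in the bounded region of the plane enclosed by $\gamma$.
   Context: A simple closed plane curve $\gamma \subset \mathbb{R}^2$ is taken to be a regular closed curve of class $C^2$ without self-intersections. Its curvature is the usual (unsigned) curvature, and "curvature at most $1$" means that it is at most $1$ at every point of $\gamma$. The diameter of $\gamma$ is $\max\{|x-y| : x,y\in\gamma\}$. The inside of $\gamma$ is the bounded connected component of $\mathbb{R}^2\setminus\gamma$ (Jordan curve theorem). *)

theory Defs
  imports "HOL-Analysis.Analysis"
begin

abbreviation vderiv :: "(real \<Rightarrow> real^2) \<Rightarrow> real \<Rightarrow> real^2" where
  "vderiv \<gamma> \<equiv> (\<lambda>t. vector_derivative \<gamma> (at t))"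

text \<open>
  A closed curve is given as a 1-periodic map on the whole line, so that being of class
  \<open>C\<^sup>2\<close> includes the matching of the derivatives at the closing point. Its trace is
  \<^term>\<open>path_image \<gamma>\<close>, the image of one period \<^term>\<open>{0..1::real}\<close>.
\<close>

definition regular_closed_C2_curve :: "(real \<Rightarrow> real^2) \<Rightarrow> bool" where
  "regular_closed_C2_curve \<gamma> \<longleftrightarrow>
     (\<forall>t. \<gamma> (t + 1) = \<gamma> t) \<and>
     \<gamma> C1_differentiable_on UNIV \<and> vderiv \<gamma> C1_differentiable_on UNIV \<and>
     (\<forall>t. vderiv \<gamma> t \<noteq> 0)"

definition simple_closed_plane_curve :: "(real \<Rightarrow> real^2) \<Rightarrow> bool" where
  "simple_closed_plane_curve \<gamma> \<longleftrightarrow> regular_closed_C2_curve \<gamma> \<and> simple_path \<gamma>"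

text \<open>
  Unsigned curvature \<open>\<bar>x' y'' - y' x''\<bar> / (x'\<^sup>2 + y'\<^sup>2)\<^sup>3\<^sup>/\<^sup>2\<close> of \<open>\<gamma> = (x, y)\<close>, valid for an
  arbitrary regular parametrization.
\<close>

definition curvature :: "(real \<Rightarrow> real^2) \<Rightarrow> real \<Rightarrow> real" where
  "curvature \<gamma> t =
     \<bar>vderiv \<gamma> t $ 1 * vderiv (vderiv \<gamma>) t $ 2 - vderiv \<gamma> t $ 2 * vderiv (vderiv \<gamma>) t $ 1\<bar>
       / norm (vderiv \<gamma> t) ^ 3"

end

theory Submission imports Defs begin

text \<open>
  The curvature bound enters only through a local rolling property: if a disc in the complement of
  the curve touches it at a point, then the unit disc on the same side with the same tangent there is
  not entered by an arc of the curve around that point whose parameter length does not depend on the point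
  (\<open>curvature_at_most_one_rolling\<close>). So the largest disc of radius at most \<open>1\<close> that touches
  the curve at \<open>x\<close> from inside has radius \<open>1\<close>, or it is stopped from growing by a second point
  \<open>x'\<close> of the curve, which it touches as well (\<open>unit_or_bitangent_disc\<close>).

  Suppose that a disc \<open>D\<close> of radius less than \<open>1\<close> touches the curve from inside at two points. The chord
  between them cuts the inside into two caps, one for each arc of the curve. As in the theorem of Pestov and
  Ionin, each arc yields a unit disc (\<open>unit_disc_in_bitangent_arc\<close>): among the discs touching
  the arc twice, take one whose two parameters are closest together, and look at the largest disc
  touching at the parameter in the middle. If its radius were less than \<open>1\<close>, it would have a second
  touching point. Inside the parameter interval this gives a closer pair. Outside, the chords of the
  two discs must cross by the Jordan curve theorem; the difference of the powers of a point with
  respect to the two circles is affine, hence vanishes at the crossing, and so the new disc touches the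
  curve at the old points too (\<open>interleaved_bitangent_discs\<close>), which is again a closer pair. The
  same affine function shows that the unit disc found in this way lies in the union of \<open>D\<close> and the cap
  (\<open>touching_disc_subset_cap\<close>).

  Now let \<open>x\<close> and \<open>y\<close> be points of the curve at distance at least \<open>4\<close>, with their maximal discs
  \<open>D\<^sub>x\<close> and \<open>D\<^sub>y\<close>. These have radius at most \<open>1\<close>, so they are disjoint. If \<open>D\<^sub>x\<close> is not a unit
  disc, let \<open>N\<^sub>x\<close> be the cap of the arc that does not contain \<open>y\<close>, otherwise let it be empty, and define
  \<open>N\<^sub>y\<close> in the same way. A connected part of the inside that avoids \<open>D\<^sub>y\<close> and has \<open>x\<close> in its
  closure cannot meet \<open>N\<^sub>y\<close>: it does not cross the boundary of \<open>N\<^sub>y\<close>, so it would be contained in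
  \<open>N\<^sub>y\<close>, and then \<open>x\<close> would lie on the arc of \<open>N\<^sub>y\<close> (\<open>connected_outside_cap\<close>). This applies to
  \<open>D\<^sub>x\<close>; with \<open>x\<close> and \<open>y\<close> exchanged it shows that \<open>D\<^sub>y\<close> does not meet \<open>N\<^sub>x\<close>, and so it
  applies to \<open>N\<^sub>x\<close> as well. Hence \<open>D\<^sub>x \<union> N\<^sub>x\<close> and \<open>D\<^sub>y \<union> N\<^sub>y\<close> are
  disjoint, and each contains a unit disc.
\<close>

section \<open>Periodic functions\<close>

lemma periodic_int:
  fixes f :: "real \<Rightarrow> 'a"
  assumes "\<And>t. f (t + 1) = f t"
  shows "f (t + of_int k) = f t"
proof -
  have nat: "f (t + real n) = f t" for t n
  proof (induction n)
    case (Suc n)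
    have "f (t + real (Suc n)) = f ((t + real n) + 1)" by (simp add: algebra_simps)
    then show ?case using assms Suc by simp
  qed simp
  show ?thesis
  proof (cases "k \<ge> 0")
    case True
    then show ?thesis using nat[of t "nat k"] by simp
  next
    case False
    then show ?thesis using nat[of "t + of_int k" "nat (-k)"] by simp
  qed
qed

lemma periodic_representative:
  fixes f :: "real \<Rightarrow> 'a"
  assumes "\<And>t. f (t + 1) = f t"
  obtains u where "a \<le> u" "u < a + 1" "f u = f x"
proof
  show "a \<le> a + frac (x - a)" "a + frac (x - a) < a + 1"
    by (auto simp: frac_lt_1)
  show "f (a + frac (x - a)) = f x"
    using periodic_int[of f x "- \<lfloor>x - a\<rfloor>", OF assms] by (simp add: frac_def)
qed

section \<open>Rolling a unit disc along a curve of curvature at most one\<close>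

text \<open>
  With arc length as parameter, \<open>\<phi> = \<bar>x - c\<bar>\<^sup>2 - 1\<close> satisfies
  \<open>\<phi>'' \<ge> 2 - 2\<bar>x - c\<bar> \<ge> -\<phi>\<close>, because \<open>1 + \<bar>x - c\<bar>\<^sup>2 \<ge> 2\<bar>x - c\<bar>\<close>. Comparison with the
  sine gives \<open>\<phi> \<ge> 0\<close> up to length \<open>\<pi>\<close>. The curve is given by its speed \<open>v\<close> and unit tangent \<open>\<tau>\<close>,
  so that no reparametrization is necessary; the bound on \<open>w\<close> is the bound \<open>1\<close> on the curvature.
\<close>

lemma rolling_unit_ball:
  fixes x \<tau> w :: "real \<Rightarrow> 'a::euclidean_space"
  assumes "0 \<le> b"
    and x: "\<And>u. u \<in> {0..b} \<Longrightarrow> (x has_vector_derivative v u *\<^sub>R \<tau> u) (at u within {0..b})"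
    and \<tau>: "\<And>u. u \<in> {0..b} \<Longrightarrow> (\<tau> has_vector_derivative w u) (at u within {0..b})"
    and unit: "\<And>u. u \<in> {0..b} \<Longrightarrow> norm (\<tau> u) = 1"
    and w: "\<And>u. u \<in> {0..b} \<Longrightarrow> norm (w u) \<le> v u"
    and v: "continuous_on {0..b} v" "\<And>u. u \<in> {0..b} \<Longrightarrow> v u \<le> V" and V: "V * b \<le> pi"
    and c: "norm (x 0 - c) = 1" "(x 0 - c) \<bullet> \<tau> 0 = 0"
  shows "1 \<le> norm (x b - c)"
proof -
  obtain S where S: "\<And>u. u \<in> {0..b} \<Longrightarrow> (S has_vector_derivative v u) (at u within {0..b})"
    using antiderivative_continuous[OF v(1)] by blast
  have S': "(S has_real_derivative v u) (at u within {0..b})" if "u \<in> {0..b}" for u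
    using S[OF that] by (simp add: has_real_derivative_iff_has_vector_derivative)
  define L where "L u = S b - S u" for u
  define \<phi> where "\<phi> u = (x u - c) \<bullet> (x u - c) - 1" for u
  define p where "p u = 2 * ((x u - c) \<bullet> \<tau> u)" for u
  \<comment> \<open>Sturm comparison: with respect to arc length, the derivative of \<open>W\<close> is \<open>(\<phi>'' + \<phi>) sin L\<close>.\<close>
  define W where "W u = p u * sin (L u) + \<phi> u * cos (L u)" for u
  have L': "(L has_real_derivative - v u) (at u within {0..b})" if "u \<in> {0..b}" for u
    unfolding L_def by (auto intro!: derivative_eq_intros S'[OF that])
  have \<phi>': "(\<phi> has_real_derivative v u * p u) (at u within {0..b})" if "u \<in> {0..b}" for u
    unfolding \<phi>_def p_def has_field_derivative_def
    using x[OF that, unfolded has_vector_derivative_def]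
    by (auto intro!: derivative_eq_intros simp: algebra_simps inner_commute fun_eq_iff)
  have p': "(p has_real_derivative 2 * v u + 2 * ((x u - c) \<bullet> w u)) (at u within {0..b})"
    if "u \<in> {0..b}" for u
  proof -
    have "\<tau> u \<bullet> \<tau> u = 1" using unit[OF that] by (simp add: dot_square_norm)
    then show ?thesis
      unfolding p_def has_field_derivative_def
      using x[OF that, unfolded has_vector_derivative_def] \<tau>[OF that, unfolded has_vector_derivative_def]
      by (auto intro!: derivative_eq_intros simp: algebra_simps inner_commute fun_eq_iff)
  qed
  have v0: "0 \<le> v u" if "u \<in> {0..b}" for u
    using w[OF that] norm_ge_zero order_trans by blast
  have Lrange: "0 \<le> L u \<and> L u \<le> pi" if u: "u \<in> {0..b}" for u
  proof -
    have Suv: "S u \<le> S u' \<and> S u' - S u \<le> V * (u' - u)" if "u \<in> {0..b}" "u' \<in> {0..b}" "u \<le> u'" for u u'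
    proof -
      have "\<exists>\<xi>\<in>{u..u'}. S u' - S u = (u' - u) * v \<xi>"
      proof (cases "u = u'")
        case False
        have "(S has_real_derivative v y) (at y within {u..u'})" if "y \<in> {u..u'}" for y
          using that \<open>u \<in> {0..b}\<close> \<open>u' \<in> {0..b}\<close> by (intro has_field_derivative_subset[OF S']) auto
        moreover have "u < u'" using that False by simp
        ultimately obtain \<xi> where "\<xi> \<in> {u<..<u'}" "S u' - S u = v \<xi> * (u' - u)"
          using mvt_simple[of u u' S "\<lambda>y h. v y * h"]
          unfolding has_field_derivative_def by fastforce
        then show ?thesis by (intro bexI[of _ \<xi>]) auto
      qed (use that in auto)
      then obtain \<xi> where "\<xi> \<in> {u..u'}" "S u' - S u = (u' - u) * v \<xi>" by blast
      moreover from this have "0 \<le> v \<xi>" "v \<xi> \<le> V" using that v0[of \<xi>] v(2)[of \<xi>] by auto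
      ultimately have "0 \<le> S u' - S u" "S u' - S u \<le> (u' - u) * V"
        using that by (auto intro: mult_left_mono)
      then show ?thesis by (simp add: mult.commute)
    qed
    have "0 \<le> V" using v0[of 0] v(2)[of 0] \<open>0 \<le> b\<close> by auto
    then have "V * (b - u) \<le> V * b" using u by (intro mult_left_mono) auto
    then show ?thesis using Suv[of u b] u \<open>0 \<le> b\<close> V by (auto simp: L_def)
  qed
  have W': "(W has_real_derivative (2 * v u + 2 * ((x u - c) \<bullet> w u) + \<phi> u * v u) * sin (L u))
      (at u within {0..b})" if "u \<in> {0..b}" for u
    unfolding W_def
    by (rule derivative_eq_intros L'[OF that] \<phi>'[OF that] p'[OF that] refl)+ (simp add: algebra_simps)
  have nonneg: "0 \<le> (2 * v u + 2 * ((x u - c) \<bullet> w u) + \<phi> u * v u) * sin (L u)" if u: "u \<in> {0..b}" for u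
  proof (rule mult_nonneg_nonneg)
    let ?n = "norm (x u - c)"
    have "\<bar>(x u - c) \<bullet> w u\<bar> \<le> ?n * v u"
      using Cauchy_Schwarz_ineq2[of "x u - c" "w u"] mult_left_mono[OF w[OF u], of ?n] by auto
    then have "- (?n * v u) \<le> (x u - c) \<bullet> w u" by linarith
    moreover have "(?n - 1)\<^sup>2 * v u = 2 * v u - 2 * (?n * v u) + \<phi> u * v u"
      by (simp add: \<phi>_def dot_square_norm power2_eq_square algebra_simps)
    moreover have "0 \<le> (?n - 1)\<^sup>2 * v u" using v0[OF u] by simp
    ultimately show "0 \<le> 2 * v u + 2 * ((x u - c) \<bullet> w u) + \<phi> u * v u" by linarith
    show "0 \<le> sin (L u)" using Lrange[OF u] by (simp add: sin_ge_zero)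
  qed
  have "W 0 \<le> W b"
  proof (cases "b = 0")
    case False
    with \<open>0 \<le> b\<close> have "0 < b" by simp
    then obtain \<xi> where \<xi>: "\<xi> \<in> {0<..<b}"
      "W b - W 0 = (2 * v \<xi> + 2 * ((x \<xi> - c) \<bullet> w \<xi>) + \<phi> \<xi> * v \<xi>) * sin (L \<xi>) * (b - 0)"
      using mvt_simple[of 0 b W "\<lambda>u h. (2 * v u + 2 * ((x u - c) \<bullet> w u) + \<phi> u * v u) * sin (L u) * h"]
        W' by (auto simp: has_field_derivative_def)
    from \<xi>(1) have "0 \<le> W b - W 0"
      unfolding \<xi>(2) using \<open>0 < b\<close> by (intro mult_nonneg_nonneg[OF nonneg]) auto
    then show ?thesis by simp
  qed simp
  moreover have "W 0 = 0" using c by (simp add: W_def p_def \<phi>_def dot_square_norm)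
  moreover have "W b = \<phi> b" by (simp add: W_def L_def)
  ultimately have "1 \<le> (norm (x b - c))\<^sup>2" by (simp add: \<phi>_def dot_square_norm)
  then show ?thesis by (intro power2_le_imp_le[of 1]) auto
qed

text \<open>
  The unit tangent turns at the rate curvature times speed; \<open>d\<close> is the velocity of a curve and \<open>k\<close>
  its signed curvature.
\<close>

lemma unit_tangent_speed:
  fixes p q :: "real^2" and d :: "real \<Rightarrow> real^2"
  assumes d: "(d has_vector_derivative q) (at t)" and p: "d t = p" "p \<noteq> 0"
  defines "k \<equiv> (p $ 1 * q $ 2 - p $ 2 * q $ 1) / norm p ^ 3"
  shows "((\<lambda>u. d u /\<^sub>R norm (d u)) has_vector_derivative k *\<^sub>R vector [- p $ 2, p $ 1]) (at t)"
    and "norm (k *\<^sub>R (vector [- p $ 2, p $ 1] :: real^2)) = \<bar>k\<bar> * norm p"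
proof -
  have np: "norm p > 0" using p by simp
  have n2: "norm p ^ 2 = p $ 1 * p $ 1 + p $ 2 * p $ 2"
    by (simp add: norm_vec_def L2_set_def UNIV_2 power2_eq_square)
  have "((\<lambda>u. norm (d u)) has_derivative (\<lambda>h. (h *\<^sub>R q) \<bullet> sgn p)) (at t)"
    using has_derivative_compose[OF d[unfolded has_vector_derivative_def] has_derivative_norm] p by simp
  then have "((\<lambda>u. norm (d u)) has_real_derivative (p \<bullet> q) / norm p) (at t)"
    by (rule has_derivative_imp_has_field_derivative) (simp add: sgn_div_norm inner_commute field_simps)
  then have "((\<lambda>u. inverse (norm (d u))) has_real_derivative - ((p \<bullet> q) / norm p ^ 3)) (at t)"
    using np p by (auto intro!: derivative_eq_intros simp: power2_eq_square power3_eq_cube field_simps)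
  from has_vector_derivative_scaleR[OF this d] have "((\<lambda>u. d u /\<^sub>R norm (d u)) has_vector_derivative
      (q /\<^sub>R norm p + (- ((p \<bullet> q) / norm p ^ 3)) *\<^sub>R p)) (at t)"
    unfolding p(1) .
  moreover have "q /\<^sub>R norm p + (- ((p \<bullet> q) / norm p ^ 3)) *\<^sub>R p = k *\<^sub>R vector [- p $ 2, p $ 1]"
  proof -
    have common: "x / norm p - y / norm p ^ 3 * z = u / norm p ^ 3 * v"
      if "x * (p $ 1 * p $ 1 + p $ 2 * p $ 2) - y * z = u * v" for x y z u v
    proof -
      have "x / norm p = x * norm p ^ 2 / norm p ^ 3"
        using np by (simp add: power2_eq_square power3_eq_cube)
      then show ?thesis
        using that unfolding n2 by (metis diff_divide_distrib times_divide_eq_left)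
    qed
    have pq: "p \<bullet> q = p $ 1 * q $ 1 + p $ 2 * q $ 2" by (simp add: inner_vec_def sum_2)
    have "q $ 1 / norm p - (p \<bullet> q) / norm p ^ 3 * p $ 1 = k * (- p $ 2)"
      "q $ 2 / norm p - (p \<bullet> q) / norm p ^ 3 * p $ 2 = k * p $ 1"
      unfolding pq k_def by (rule common; simp add: algebra_simps)+
    then show ?thesis by (simp add: vec_eq_iff forall_2 divide_inverse_commute)
  qed
  ultimately show "((\<lambda>u. d u /\<^sub>R norm (d u)) has_vector_derivative k *\<^sub>R vector [- p $ 2, p $ 1]) (at t)"
    by simp
  have "norm (vector [- p $ 2, p $ 1] :: real^2) = norm p"
    by (simp add: norm_vec_def L2_set_def UNIV_2 add.commute)
  then show "norm (k *\<^sub>R (vector [- p $ 2, p $ 1] :: real^2)) = \<bar>k\<bar> * norm p" by simp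
qed

text \<open>
  The distance from the centre of a disc that misses the curve is minimal at the touching point, so the
  radius there is normal to the curve and \<open>rolling_unit_ball\<close> applies in both directions, up to
  arc length \<open>\<pi>\<close>. The conclusion is stated in terms of distances, which makes it invariant under
  isometries and free of derivatives.
\<close>

lemma curvature_at_most_one_rolling:
  assumes reg: "regular_closed_C2_curve \<gamma>" and curv: "\<And>t. curvature \<gamma> t \<le> 1"
  obtains \<delta> where "0 < \<delta>"
    "\<And>t u c r. 0 < r \<Longrightarrow> dist c (\<gamma> t) = r \<Longrightarrow> ball c r \<inter> range \<gamma> = {} \<Longrightarrow> \<bar>u - t\<bar> \<le> \<delta>
       \<Longrightarrow> \<gamma> u \<notin> ball (\<gamma> t + (c - \<gamma> t) /\<^sub>R r) 1"
proof -
  have per: "\<gamma> (t + 1) = \<gamma> t" for t using reg by (auto simp: regular_closed_C2_curve_def)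
  obtain d e where d: "\<And>t. (\<gamma> has_vector_derivative d t) (at t)" "continuous_on UNIV d"
    and e: "\<And>t. (vderiv \<gamma> has_vector_derivative e t) (at t)"
    using reg by (auto simp: regular_closed_C2_curve_def C1_differentiable_on_def)
  have deq: "vderiv \<gamma> = d" using d(1) vector_derivative_at by blast
  have nz: "d t \<noteq> 0" for t
    using reg fun_cong[OF deq, of t] unfolding regular_closed_C2_curve_def by metis
  have perd: "d (t + 1) = d t" for t
  proof -
    have "(\<gamma> \<circ> (\<lambda>t. t + 1) has_vector_derivative 1 *\<^sub>R d (t + 1)) (at t)"
      by (rule vector_diff_chain_at) (auto intro!: derivative_eq_intros d)
    then have "(\<gamma> has_vector_derivative d (t + 1)) (at t)" by (simp add: o_def per)
    then show ?thesis using d(1) vector_derivative_unique_at by blast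
  qed
  obtain V where V: "\<And>t. norm (d t) \<le> V" "0 < V"
  proof -
    have "compact (d ` {0..1})" by (intro compact_continuous_image continuous_on_subset[OF d(2)]) auto
    then obtain V where V: "0 < V" "\<And>t. t \<in> {0..1} \<Longrightarrow> norm (d t) \<le> V"
      using compact_imp_bounded bounded_pos by (metis imageI)
    have "norm (d t) \<le> V" for t
    proof -
      obtain u where "0 \<le> u" "u < 0 + 1" "d u = d t" using periodic_representative[of d 0 t] perd by blast
      then show ?thesis using V(2)[of u] by auto
    qed
    then show thesis using V that by blast
  qed
  define \<tau> where "\<tau> t = d t /\<^sub>R norm (d t)" for t
  define k where "k t = (d t $ 1 * e t $ 2 - d t $ 2 * e t $ 1) / norm (d t) ^ 3" for t
  define w where "w t = k t *\<^sub>R (vector [- d t $ 2, d t $ 1] :: real^2)" for t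
  have \<tau>': "(\<tau> has_vector_derivative w t) (at t)" for t
    unfolding \<tau>_def w_def k_def using unit_tangent_speed(1)[OF e[unfolded deq] refl nz] .
  have w: "norm (w t) \<le> norm (d t)" for t
  proof -
    have "\<bar>k t\<bar> = curvature \<gamma> t"
      by (simp add: curvature_def vector_derivative_at[OF d(1)] vector_derivative_at[OF e[unfolded deq]] k_def)
    then have "\<bar>k t\<bar> * norm (d t) \<le> norm (d t)" using curv by (intro mult_left_le_one_le) auto
    from this[unfolded k_def] show ?thesis
      unfolding w_def k_def unit_tangent_speed(2)[OF e[unfolded deq] refl nz] .
  qed
  have unit: "norm (\<tau> t) = 1" for t using nz by (simp add: \<tau>_def)
  have \<gamma>': "(\<gamma> has_vector_derivative norm (d t) *\<^sub>R \<tau> t) (at t)" for t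
    using d(1) nz by (simp add: \<tau>_def)
  have key: "1 \<le> norm (\<gamma> u - c)"
    if c: "norm (\<gamma> t - c) = 1" "(\<gamma> t - c) \<bullet> \<tau> t = 0" and u: "\<bar>u - t\<bar> \<le> pi / V" for c t u
  proof (cases "t \<le> u")
    case True
    have "1 \<le> norm (\<gamma> (t + (u - t)) - c)"
    proof (rule rolling_unit_ball[where b = "u - t" and x = "\<lambda>s. \<gamma> (t + s)" and \<tau> = "\<lambda>s. \<tau> (t + s)"
            and w = "\<lambda>s. w (t + s)" and v = "\<lambda>s. norm (d (t + s))" and V = V and c = c])
      fix s
      have "(\<gamma> \<circ> (\<lambda>s. t + s) has_vector_derivative 1 *\<^sub>R (norm (d (t + s)) *\<^sub>R \<tau> (t + s))) (at s within {0..u-t})"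
        by (rule vector_diff_chain_within)
           (auto intro!: derivative_eq_intros has_vector_derivative_at_within[OF \<gamma>'])
      then show "((\<lambda>s. \<gamma> (t + s)) has_vector_derivative norm (d (t + s)) *\<^sub>R \<tau> (t + s)) (at s within {0..u-t})"
        by (simp add: o_def)
      have "(\<tau> \<circ> (\<lambda>s. t + s) has_vector_derivative 1 *\<^sub>R (w (t + s))) (at s within {0..u-t})"
        by (rule vector_diff_chain_within)
           (auto intro!: derivative_eq_intros has_vector_derivative_at_within[OF \<tau>'])
      then show "((\<lambda>s. \<tau> (t + s)) has_vector_derivative w (t + s)) (at s within {0..u-t})"
        by (simp add: o_def)
      show "continuous_on {0..u - t} (\<lambda>s. norm (d (t + s)))"
        by (intro continuous_intros continuous_on_compose2[OF d(2)]) auto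
      show "V * (u - t) \<le> pi" using u V(2) True by (simp add: field_simps)
    qed (use True c V(1) unit w in auto)
    then show ?thesis by simp
  next
    case False
    have "1 \<le> norm (\<gamma> (t - (t - u)) - c)"
    proof (rule rolling_unit_ball[where b = "t - u" and x = "\<lambda>s. \<gamma> (t - s)" and \<tau> = "\<lambda>s. - \<tau> (t - s)"
            and w = "\<lambda>s. w (t - s)" and v = "\<lambda>s. norm (d (t - s))" and V = V and c = c])
      fix s
      have "(\<gamma> \<circ> (\<lambda>s. t - s) has_vector_derivative (-1) *\<^sub>R (norm (d (t - s)) *\<^sub>R \<tau> (t - s))) (at s within {0..t-u})"
        by (rule vector_diff_chain_within)
           (auto intro!: derivative_eq_intros has_vector_derivative_at_within[OF \<gamma>'])
      then show "((\<lambda>s. \<gamma> (t - s)) has_vector_derivative norm (d (t - s)) *\<^sub>R - \<tau> (t - s)) (at s within {0..t-u})"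
        by (simp add: o_def)
      have "(\<tau> \<circ> (\<lambda>s. t - s) has_vector_derivative (-1) *\<^sub>R (w (t - s))) (at s within {0..t-u})"
        by (rule vector_diff_chain_within)
           (auto intro!: derivative_eq_intros has_vector_derivative_at_within[OF \<tau>'])
      from has_vector_derivative_minus[OF this]
      show "((\<lambda>s. - \<tau> (t - s)) has_vector_derivative w (t - s)) (at s within {0..t-u})"
        by (simp add: o_def)
      show "continuous_on {0..t - u} (\<lambda>s. norm (d (t - s)))"
        by (intro continuous_intros continuous_on_compose2[OF d(2)]) auto
      show "V * (t - u) \<le> pi" using u V(2) False by (simp add: field_simps)
    qed (use False c V(1) unit w in auto)
    then show ?thesis by simp
  qed
  show thesis
  proof
    show "0 < pi / V" using V by simp
    fix t u c r
    assume r: "0 < r" and dist: "dist c (\<gamma> t) = r" and empty: "ball c r \<inter> range \<gamma> = {}"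
      and u: "\<bar>u - t\<bar> \<le> pi / V"
    define c' where "c' = \<gamma> t + (c - \<gamma> t) /\<^sub>R r"
    have diff: "\<gamma> t - c' = (\<gamma> t - c) /\<^sub>R r" by (simp add: c'_def scaleR_right_diff_distrib)
    have "((\<lambda>u. (\<gamma> u - c) \<bullet> (\<gamma> u - c)) has_real_derivative 2 * ((\<gamma> t - c) \<bullet> d t)) (at t)"
      unfolding has_field_derivative_def using d(1)[of t, unfolded has_vector_derivative_def]
      by (auto intro!: derivative_eq_intros simp: algebra_simps inner_commute fun_eq_iff)
    then have "2 * ((\<gamma> t - c) \<bullet> d t) = 0"
    proof (rule DERIV_local_min)
      show "(0::real) < 1" by simp
      show "\<forall>y. \<bar>t - y\<bar> < 1 \<longrightarrow> (\<gamma> t - c) \<bullet> (\<gamma> t - c) \<le> (\<gamma> y - c) \<bullet> (\<gamma> y - c)"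
      proof (intro allI impI)
        fix y
        have "\<gamma> y \<notin> ball c r" using empty by auto
        then have "norm (\<gamma> t - c) \<le> norm (\<gamma> y - c)" using dist by (auto simp: dist_norm norm_minus_commute)
        then show "(\<gamma> t - c) \<bullet> (\<gamma> t - c) \<le> (\<gamma> y - c) \<bullet> (\<gamma> y - c)" by (simp add: norm_le)
      qed
    qed
    then have "(\<gamma> t - c') \<bullet> \<tau> t = 0" by (simp add: diff \<tau>_def)
    moreover have "norm (\<gamma> t - c') = 1" using r dist by (simp add: diff dist_norm norm_minus_commute)
    ultimately have "1 \<le> norm (\<gamma> u - c')" using key u by blast
    then show "\<gamma> u \<notin> ball (\<gamma> t + (c - \<gamma> t) /\<^sub>R r) 1"
      by (simp add: c'_def[symmetric] dist_norm norm_minus_commute)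
  qed
qed

section \<open>Tangent discs and pairs of circles\<close>

text \<open>
  The discs touching a given line at a point \<open>p\<close> from one side form the family
  \<open>ball (p + k *\<^sub>R (c - p)) (k * r)\<close>. This linear criterion makes the family visibly increasing in \<open>k\<close>.
\<close>

lemma mem_ball_tangent:
  fixes p :: "'a::real_inner"
  assumes "dist c p = r" "0 < k"
  shows "x \<in> ball (p + k *\<^sub>R (c - p)) (k * r) \<longleftrightarrow> (x - p) \<bullet> (x - p) < 2 * k * ((x - p) \<bullet> (c - p))"
proof -
  have iff: "norm (y - v) < norm v \<longleftrightarrow> y \<bullet> y < 2 * (y \<bullet> v)" for y v :: 'a
    unfolding norm_lt by (simp add: inner_diff_left inner_diff_right inner_commute[of v y])
  have "k * r = norm (k *\<^sub>R (c - p))" using assms by (simp add: dist_norm)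
  moreover have "dist (p + k *\<^sub>R (c - p)) x = norm ((x - p) - k *\<^sub>R (c - p))"
    by (metis diff_diff_eq dist_commute dist_norm)
  ultimately show ?thesis using iff[of "x - p" "k *\<^sub>R (c - p)"] by (simp add: mult.assoc)
qed

lemma mem_cball_tangent:
  fixes p :: "'a::real_inner"
  assumes "dist c p = r"
  shows "x \<in> cball c r \<longleftrightarrow> (x - p) \<bullet> (x - p) \<le> 2 * ((x - p) \<bullet> (c - p))"
proof -
  have iff: "norm (y - v) \<le> norm v \<longleftrightarrow> y \<bullet> y \<le> 2 * (y \<bullet> v)" for y v :: 'a
    unfolding norm_le by (simp add: inner_diff_left inner_diff_right inner_commute[of v y])
  show ?thesis using iff[of "x - p" "c - p"] assms by (simp add: dist_norm norm_minus_commute)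
qed

lemma ball_tangent_mono:
  fixes p :: "'a::real_inner"
  assumes "dist c p = r" "0 < k" "k \<le> l"
  shows "ball (p + k *\<^sub>R (c - p)) (k * r) \<subseteq> ball (p + l *\<^sub>R (c - p)) (l * r)"
proof
  fix x assume "x \<in> ball (p + k *\<^sub>R (c - p)) (k * r)"
  then have x: "(x - p) \<bullet> (x - p) < k * (2 * ((x - p) \<bullet> (c - p)))"
    using mem_ball_tangent[OF assms(1,2)] by (simp add: mult_ac)
  then have "0 < k * (2 * ((x - p) \<bullet> (c - p)))" using inner_ge_zero order_le_less_trans by blast
  then have "0 \<le> 2 * ((x - p) \<bullet> (c - p))" using assms(2) by (simp add: zero_less_mult_iff)
  from x mult_right_mono[OF assms(3) this] show "x \<in> ball (p + l *\<^sub>R (c - p)) (l * r)"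
    using mem_ball_tangent[OF assms(1), of l x] assms by (simp add: mult_ac)
qed

lemma cball_tangent_strict:
  fixes p :: "'a::real_inner"
  assumes "dist c p = r" "1 < l" "x \<in> cball c r" "x \<noteq> p"
  shows "x \<in> ball (p + l *\<^sub>R (c - p)) (l * r)"
proof -
  have x: "(x - p) \<bullet> (x - p) \<le> 2 * ((x - p) \<bullet> (c - p))"
    using mem_cball_tangent[OF assms(1)] assms(3) by blast
  have "0 < (x - p) \<bullet> (x - p)" using assms(4) by simp
  with x have "0 < 2 * ((x - p) \<bullet> (c - p))" by linarith
  then have "1 * (2 * ((x - p) \<bullet> (c - p))) < l * (2 * ((x - p) \<bullet> (c - p)))"
    using assms(2) by (rule mult_strict_right_mono[rotated])
  with x show ?thesis using mem_ball_tangent[OF assms(1), of l x] assms(2) by (simp add: mult_ac)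
qed

text \<open>
  The power of a point with respect to one circle minus its power with respect to another; the zero
  set is the radical axis.
\<close>

definition power_difference :: "'a::real_inner \<Rightarrow> real \<Rightarrow> 'a \<Rightarrow> real \<Rightarrow> 'a \<Rightarrow> real" where
  "power_difference c r c' r' x = ((dist c x)\<^sup>2 - r\<^sup>2) - ((dist c' x)\<^sup>2 - r'\<^sup>2)"

lemma power_difference_affine:
  "power_difference c r c' r' ((1 - u) *\<^sub>R a + u *\<^sub>R b) =
     (1 - u) * power_difference c r c' r' a + u * power_difference c r c' r' b"
proof -
  have "power_difference c r c' r' x = (c \<bullet> c - r\<^sup>2) - (c' \<bullet> c' - r'\<^sup>2) - 2 * ((c - c') \<bullet> x)" for x
    by (simp add: power_difference_def dist_norm power2_norm_eq_inner algebra_simps inner_commute)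
  note eq = this
  show ?thesis unfolding eq inner_add_right inner_scaleR_right by (simp add: algebra_simps)
qed

text \<open>
  The difference is nonpositive at both ends of the chord. Since it is affine, it is nonpositive on the whole
  chord, and a zero inside the chord forces zeros at the ends.
\<close>

lemma power_difference_chord:
  assumes "dist c a = r" "dist c b = r" "a \<notin> ball c' r'" "b \<notin> ball c' r'" "0 \<le> r'"
  shows "x \<in> closed_segment a b \<Longrightarrow> power_difference c r c' r' x \<le> 0"
    and "x \<in> open_segment a b \<Longrightarrow> power_difference c r c' r' x = 0 \<Longrightarrow> dist c' a = r'"
proof -
  have le: "power_difference c r c' r' y \<le> 0" if "dist c y = r" "y \<notin> ball c' r'" for y
    using that assms(5) by (simp add: power_difference_def)
  note a = le[OF assms(1,3)] and b = le[OF assms(2,4)]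
  show "x \<in> closed_segment a b \<Longrightarrow> power_difference c r c' r' x \<le> 0"
    using a b by (auto simp: in_segment power_difference_affine intro!: add_nonpos_nonpos mult_nonneg_nonpos)
  assume "x \<in> open_segment a b" and zero: "power_difference c r c' r' x = 0"
  then obtain u where u: "0 < u" "u < 1" "x = (1 - u) *\<^sub>R a + u *\<^sub>R b"
    by (auto simp: in_segment)
  then have "(1 - u) * power_difference c r c' r' a + u * power_difference c r c' r' b = 0"
    using zero by (simp add: power_difference_affine)
  moreover have "u * power_difference c r c' r' b \<le> 0" using u b by (intro mult_nonneg_nonpos) auto
  ultimately have "0 \<le> (1 - u) * power_difference c r c' r' a" by linarith
  then have "power_difference c r c' r' a = 0" using u a by (simp add: zero_le_mult_iff)
  then show "dist c' a = r'"
    using assms by (simp add: power_difference_def power2_eq_iff_nonneg)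
qed

lemma open_chord_subset_ball:
  fixes c :: "'a::euclidean_space"
  assumes "dist c a = r" "dist c b = r"
  shows "open_segment a b \<subseteq> ball c r"
  using dist_decreases_open_segment[of _ a b c] assms by fastforce

section \<open>Caps cut off a Jordan domain by a chord\<close>

text \<open>
  A simple closed curve as a map on the whole line. Its arcs are then the images of intervals
  \<open>{s..t}\<close> with \<open>t < s + 1\<close>, wherever the base point lies, and the complementary arc is the image of
  \<open>{t..s+1}\<close>.
\<close>

locale jordan_loop =
  fixes g :: "real \<Rightarrow> complex"
  assumes periodic: "g (t + 1) = g t"
    and continuous: "continuous_on UNIV g"
    and injective: "g u = g v \<Longrightarrow> \<bar>u - v\<bar> < 1 \<Longrightarrow> u = v"
begin

abbreviation interior_region :: "complex set" where
  "interior_region \<equiv> inside (range g)"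

definition cap :: "real \<Rightarrow> real \<Rightarrow> complex set" where
  "cap s t = inside (g ` {s..t} \<union> closed_segment (g s) (g t))"

lemmas shift_int = periodic_int[of g, OF periodic]
lemmas representative = periodic_representative[of g, OF periodic]

lemma range_period: "range g = g ` {a..a+1}"
proof
  show "range g \<subseteq> g ` {a..a+1}"
  proof
    fix p assume "p \<in> range g"
    then obtain x where "p = g x" by auto
    moreover obtain u where "a \<le> u" "u < a + 1" "g u = g x" using representative by blast
    ultimately show "p \<in> g ` {a..a+1}" by (intro image_eqI[of p g u]) auto
  qed
qed auto

lemma compact_range: "compact (range g)"
  unfolding range_period[of 0]
  by (intro compact_continuous_image continuous_on_subset[OF continuous]) auto

lemma closed_range: "closed (range g)"
  using compact_range compact_imp_closed by blast

lemma arc_subpath_less_period: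
  assumes "s < t" "t < s + 1"
  shows "arc (subpath s t g)"
proof -
  have "inj_on (subpath s t g) {0..1}"
  proof (rule inj_onI)
    fix x y assume x: "x \<in> {0..1::real}" and y: "y \<in> {0..1::real}" and eq: "subpath s t g x = subpath s t g y"
    have "\<bar>x - y\<bar> \<le> 1" using x y by auto
    then have "(t - s) * \<bar>x - y\<bar> \<le> (t - s) * 1" using assms by (intro mult_left_mono) auto
    then have "(t - s) * \<bar>x - y\<bar> < 1" by (rule le_less_trans) (use assms in simp)
    then have "\<bar>((t - s) * x + s) - ((t - s) * y + s)\<bar> < 1"
      using assms by (simp add: right_diff_distrib[symmetric] abs_mult)
    then have "(t - s) * x + s = (t - s) * y + s"
      using eq injective unfolding subpath_def by blast
    then show "x = y" using assms by simp
  qed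
  moreover have "path (subpath s t g)"
    unfolding path_def subpath_def
    by (intro continuous_on_compose2[OF continuous] continuous_intros) auto
  ultimately show ?thesis by (simp add: arc_def)
qed

lemma path_image_subpath_le:
  "s \<le> t \<Longrightarrow> path_image (subpath s t g) = g ` {s..t}"
  by (simp add: path_image_subpath_gen closed_segment_eq_real_ivl)

lemma arcs_meet:
  assumes "s < t" "t < s + 1"
  shows "g ` {s..t} \<inter> g ` {t..s+1} = {g s, g t}"
proof
  show "g ` {s..t} \<inter> g ` {t..s+1} \<subseteq> {g s, g t}"
  proof
    fix p assume "p \<in> g ` {s..t} \<inter> g ` {t..s+1}"
    then obtain u v where u: "s \<le> u" "u \<le> t" "p = g u" and v: "t \<le> v" "v \<le> s+1" "p = g v"
      by auto
    show "p \<in> {g s, g t}"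
    proof (cases "v - u < 1")
      case True
      then have "u = v" using injective[of u v] u v assms by auto
      then show ?thesis using u v by auto
    next
      case False
      then have "u = s" using u v by auto
      then show ?thesis using u by auto
    qed
  qed
  show "{g s, g t} \<subseteq> g ` {s..t} \<inter> g ` {t..s+1}"
    using assms periodic[of s] by (auto intro!: image_eqI[of "g s" g "s+1"])
qed

lemma arcs_cover:
  assumes "s < t" "t < s + 1"
  shows "g ` {s..t} \<union> g ` {t..s+1} = range g"
  using assms by (auto simp: range_period[of s] image_Un[symmetric] ivl_disj_un)

lemma chord_disjoint_range:
  assumes "open_segment (g s) (g t) \<subseteq> interior_region"
  shows "open_segment (g s) (g t) \<inter> range g = {}"
  using assms inside_no_overlap[of "range g"] by blast

lemma endpoints_distinct:
  assumes "s < t" "t < s + 1"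
  shows "g s \<noteq> g t"
  using injective[of s t] assms by auto

lemma arc_chord_meet:
  assumes "s \<le> t" "open_segment (g s) (g t) \<subseteq> interior_region"
  shows "g ` {s..t} \<inter> closed_segment (g s) (g t) = {g s, g t}"
  using chord_disjoint_range[OF assms(2)] assms(1)
  by (auto simp: closed_segment_eq_open)

lemma simple_loop_arc_chord:
  assumes "s < t" "t < s + 1" "open_segment (g s) (g t) \<subseteq> interior_region"
  shows "simple_path (subpath s t g +++ linepath (g t) (g s))"
    and "path_image (subpath s t g +++ linepath (g t) (g s)) = g ` {s..t} \<union> closed_segment (g s) (g t)"
proof -
  have le: "s \<le> t" using assms by simp
  show "simple_path (subpath s t g +++ linepath (g t) (g s))"
    using arc_chord_meet[OF le assms(3)]
    by (intro simple_path_join_loop)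
       (auto simp: arc_subpath_less_period assms(1,2) endpoints_distinct[OF assms(1,2), symmetric]
          path_image_subpath_le[OF le] closed_segment_commute[of "g t"] intro!: arc_linepath)
  show "path_image (subpath s t g +++ linepath (g t) (g s)) = g ` {s..t} \<union> closed_segment (g s) (g t)"
    by (simp add: path_image_join path_image_subpath_le[OF le] closed_segment_commute[of "g t"])
qed

lemma cap_Jordan:
  assumes "s < t" "t < s + 1" "open_segment (g s) (g t) \<subseteq> interior_region"
  shows "connected (cap s t)"
    "frontier (cap s t) = g ` {s..t} \<union> closed_segment (g s) (g t)"
  using Jordan_inside_outside[OF simple_loop_arc_chord(1)[OF assms]]
  unfolding simple_loop_arc_chord(2)[OF assms] cap_def by auto

lemma frontier_interior_region: "frontier interior_region = range g"
proof -
  have "simple_path (subpath 0 1 g)"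
    unfolding subpath_def simple_path_def loop_free_def path_def
  proof (intro conjI ballI impI)
    show "continuous_on {0..1} (\<lambda>x. g ((1 - 0) * x + 0))"
      by (intro continuous_on_compose2[OF continuous] continuous_intros) auto
    fix x y :: real assume "x \<in> {0..1}" "y \<in> {0..1}" "g ((1 - 0) * x + 0) = g ((1 - 0) * y + 0)"
    then show "x = y \<or> x = 0 \<and> y = 1 \<or> x = 1 \<and> y = 0"
      using injective[of x y] by fastforce
  qed
  then have sp: "simple_path g" by simp
  have "pathfinish g = pathstart g" using periodic[of 0] by (simp add: pathfinish_def pathstart_def)
  moreover have "path_image g = range g" using range_period[of 0] by (simp add: path_image_def)
  ultimately show ?thesis
    using Jordan_inside_outside[OF sp] by auto
qed

lemma interior_region_cut_by_chord:
  assumes "s < t" "t < s + 1" and chord: "open_segment (g s) (g t) \<subseteq> interior_region"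
  shows "cap s t \<union> cap t (s + 1) \<union> open_segment (g s) (g t) = interior_region"
proof -
  let ?c1 = "subpath s t g" and ?c2 = "reversepath (subpath t (s+1) g)" and ?c = "linepath (g s) (g t)"
  have im1: "path_image ?c1 = g ` {s..t}" and im2: "path_image ?c2 = g ` {t..s+1}"
    using assms by (simp_all add: path_image_subpath_le)
  have gs: "g (s + 1) = g s" by (rule periodic)
  have ne: "g s \<noteq> g t" by (rule endpoints_distinct[OF assms(1,2)])
  have sp1: "simple_path ?c1" using arc_subpath_less_period[OF assms(1,2)] arc_imp_simple_path by blast
  have sp2: "simple_path ?c2"
    using arc_subpath_less_period[of t "s+1"] assms arc_imp_simple_path simple_path_reversepath by auto
  have sp: "simple_path ?c" using ne by (simp add: arc_imp_simple_path arc_linepath)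
  have m12: "path_image ?c1 \<inter> path_image ?c2 = {g s, g t}"
    unfolding im1 im2 by (rule arcs_meet[OF assms(1,2)])
  have m1: "path_image ?c1 \<inter> path_image ?c = {g s, g t}"
    unfolding im1 path_image_linepath using assms by (intro arc_chord_meet) auto
  have m2: "path_image ?c2 \<inter> path_image ?c = {g s, g t}"
    unfolding im2 path_image_linepath using arc_chord_meet[of t "s+1"] assms gs
    by (simp add: closed_segment_commute[of "g t"] open_segment_commute[of "g t"] insert_commute)
  have un: "path_image ?c1 \<union> path_image ?c2 = range g"
    unfolding im1 im2 by (rule arcs_cover[OF assms(1,2)])
  have "open_segment (g s) (g t) \<noteq> {}" using ne by simp
  then have ins: "path_image ?c \<inter> inside (path_image ?c1 \<union> path_image ?c2) \<noteq> {}"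
    unfolding un path_image_linepath using chord segment_open_subset_closed[of "g s" "g t"] by blast
  have c1: "cap s t = inside (path_image ?c1 \<union> path_image ?c)"
    unfolding cap_def im1 path_image_linepath ..
  have c2: "cap t (s+1) = inside (path_image ?c2 \<union> path_image ?c)"
    unfolding cap_def im2 path_image_linepath gs closed_segment_commute[of "g t"] ..
  have seg: "open_segment (g s) (g t) = path_image ?c - {g s, g t}"
    by (simp add: open_segment_def)
  have ends: "pathstart ?c1 = g s" "pathfinish ?c1 = g t" "pathstart ?c2 = g s" "pathfinish ?c2 = g t"
    "pathstart ?c = g s" "pathfinish ?c = g t"
    by (simp_all add: gs)
  show ?thesis
    unfolding c1 c2 seg un[symmetric]
    by (rule split_inside_simple_closed_curve[OF sp1 ends(1,2) sp2 ends(3,4) sp ends(5,6) ne m12 m1 m2 ins])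
qed

lemma cap_subset_interior:
  assumes "s < t" "t < s + 1" "open_segment (g s) (g t) \<subseteq> interior_region"
  shows "cap s t \<subseteq> interior_region"
  using interior_region_cut_by_chord[OF assms] by blast

text \<open>
  A connected subset of the inside that avoids the chord also avoids the boundary of the cap. If it met the
  cap, it would be contained in it, but \<open>p\<close> is not in the closure of the cap.
\<close>

lemma connected_outside_cap:
  assumes st: "s < t" "t < s + 1" and chord: "open_segment (g s) (g t) \<subseteq> interior_region"
    and C: "connected C" "C \<subseteq> interior_region" "C \<inter> open_segment (g s) (g t) = {}"
    and p: "p \<in> closure C" "p \<in> range g" "p \<notin> g ` {s..t}"
  shows "C \<inter> cap s t = {}"
proof (rule ccontr)
  note J = cap_Jordan[OF st chord]
  assume ne: "C \<inter> cap s t \<noteq> {}"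
  have ends: "g s \<in> g ` {s..t}" "g t \<in> g ` {s..t}" using st by auto
  have "C \<inter> range g = {}" using C(2) inside_no_overlap[of "range g"] by blast
  then have "C \<inter> frontier (cap s t) = {}"
    using C(3) ends unfolding J(2) closed_segment_eq_open by blast
  then have "C \<subseteq> cap s t"
    using connected_Int_frontier[OF C(1), of "cap s t"] ne by blast
  then have "p \<in> closure (cap s t)" using p(1) closure_mono by blast
  then have "p \<in> cap s t \<union> g ` {s..t} \<union> closed_segment (g s) (g t)"
    unfolding closure_Un_frontier J(2) by blast
  moreover have "p \<notin> cap s t"
    using cap_subset_interior[OF st chord] p(2) inside_no_overlap[of "range g"] by blast
  moreover have "p \<notin> closed_segment (g s) (g t)"
    using p(2,3) ends chord_disjoint_range[OF chord] unfolding closed_segment_eq_open by blast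
  ultimately show False using p(3) by blast
qed

end

section \<open>Discs touching a loop from inside\<close>

text \<open>
  What remains of the curvature bound: at a point touched by a disc that avoids the loop, the unit disc
  with the same tangent is free of nearby points of the loop.
\<close>

locale rolling_loop = jordan_loop +
  fixes \<delta> :: real
  assumes \<delta>_pos: "0 < \<delta>"
    and rolling: "0 < r \<Longrightarrow> dist c (g t) = r \<Longrightarrow> ball c r \<inter> range g = {} \<Longrightarrow> \<bar>u - t\<bar> \<le> \<delta>
       \<Longrightarrow> g u \<notin> ball (g t + (c - g t) /\<^sub>R r) 1"
begin

definition touching_disc :: "real \<Rightarrow> complex \<Rightarrow> real \<Rightarrow> bool" where
  "touching_disc t c r \<longleftrightarrow> 0 < r \<and> r \<le> 1 \<and> dist c (g t) = r \<and> ball c r \<subseteq> interior_region"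

lemma range_interior_disjoint: "g u \<notin> interior_region"
  using inside_no_overlap[of "range g"] by blast

lemma touching_disc_avoids: "touching_disc t c r \<Longrightarrow> g u \<notin> ball c r"
  using range_interior_disjoint by (auto simp: touching_disc_def)

lemma ball_subset_interior_region:
  assumes "ball c r \<inter> range g = {}" "ball c r \<inter> interior_region \<noteq> {}"
  shows "ball c r \<subseteq> interior_region"
  using connected_Int_frontier[OF connected_ball[of c r], of interior_region] assms frontier_interior_region
  by blast

lemma ball_subset_interior_iff: "ball c r \<subseteq> interior_region \<longleftrightarrow> (\<forall>y\<in>-interior_region. r \<le> dist c y)"
  by (auto simp: subset_iff not_less[symmetric])

text \<open>
  The loop is simple, hence close points of it have close parameters, up to the period, uniformly.
\<close>

lemma near_parameter:
  obtains \<epsilon> where "0 < \<epsilon>" "\<And>t u. dist (g t) (g u) < \<epsilon> \<Longrightarrow> \<exists>u'. g u' = g u \<and> \<bar>u' - t\<bar> \<le> \<delta>"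
proof -
  let ?K = "{0..1::real} \<times> {\<delta>..1/2::real}"
  have cont: "continuous_on ?K (\<lambda>(t,h). dist (g t) (g (t + h)))"
    unfolding case_prod_beta by (intro continuous_intros continuous_on_compose2[OF continuous]) auto
  \<comment> \<open>Any two points of the loop have parameters at most half a period apart.\<close>
  obtain \<epsilon> where \<epsilon>: "0 < \<epsilon>" "\<And>t h. t \<in> {0..1} \<Longrightarrow> h \<in> {\<delta>..1/2} \<Longrightarrow> \<epsilon> \<le> dist (g t) (g (t + h))"
  proof (cases "?K = {}")
    case True
    then show thesis using that[of 1] by auto
  next
    case False
    have "compact ?K" by (intro compact_Times compact_Icc)
    then obtain x where x: "x \<in> ?K" "\<And>y. y \<in> ?K \<Longrightarrow> (\<lambda>(t,h). dist (g t) (g (t + h))) x \<le> (\<lambda>(t,h). dist (g t) (g (t + h))) y"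
      using continuous_attains_inf[OF _ False cont] by blast
    obtain t h where th: "x = (t, h)" by force
    then have "g t \<noteq> g (t + h)" using injective[of t "t + h"] x(1) \<delta>_pos by auto
    then show thesis using that[of "dist (g t) (g (t + h))"] x(2) th by auto
  qed
  have gap: "\<epsilon> \<le> dist (g t) (g (t + h))" if h: "h \<in> {\<delta>..1/2}" for t h
  proof -
    have "frac t \<in> {0..1}" by (simp add: less_imp_le frac_lt_1)
    then have "\<epsilon> \<le> dist (g (frac t)) (g (frac t + h))" using \<epsilon>(2) h by blast
    moreover have "g (frac t) = g t" "g (frac t + h) = g (t + h)"
      using shift_int[of t "- \<lfloor>t\<rfloor>"] shift_int[of "t + h" "- \<lfloor>t\<rfloor>"]
      by (simp_all add: frac_def algebra_simps)
    ultimately show ?thesis by simp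
  qed
  show thesis
  proof
    fix t u assume d: "dist (g t) (g u) < \<epsilon>"
    obtain u' where u': "t - 1/2 \<le> u'" "u' < t - 1/2 + 1" "g u' = g u" using representative by blast
    have "\<bar>u' - t\<bar> < \<delta>"
    proof (rule ccontr)
      assume "\<not> \<bar>u' - t\<bar> < \<delta>"
      moreover have "\<bar>u' - t\<bar> \<le> 1/2" using u' by linarith
      ultimately have "\<bar>u' - t\<bar> \<in> {\<delta>..1/2}" by simp
      then show False
        using gap[of "\<bar>u' - t\<bar>" "min u' t"] d u'
        by (cases "u' \<le> t") (auto simp: dist_commute)
    qed
    then show "\<exists>u'. g u' = g u \<and> \<bar>u' - t\<bar> \<le> \<delta>" using u' by force
  qed (rule \<epsilon>)
qed

text \<open>
  Points are used in place of parameters, since the parameter line is not compact.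
\<close>

lemma compact_touching_balls:
  "compact {(p, c, r). p \<in> range g \<and> \<rho> \<le> r \<and> r \<le> 1 \<and> dist c p = r \<and> ball c r \<subseteq> interior_region}"
    (is "compact ?S")
proof -
  let ?K = "{x. \<rho> \<le> snd (snd x) \<and> snd (snd x) \<le> 1 \<and> dist (fst (snd x)) (fst x) = snd (snd x) \<and>
      (\<forall>y. y \<in> -interior_region \<longrightarrow> snd (snd x) \<le> dist (fst (snd x)) y)}"
  have closed: "closed ?K"
    by (intro closed_Collect_conj closed_Collect_le closed_Collect_eq closed_Collect_all
        closed_Collect_imp open_Collect_const continuous_intros)
  obtain B where B: "\<And>p. p \<in> range g \<Longrightarrow> norm p \<le> B"
    using compact_imp_bounded[OF compact_range] by (auto simp: bounded_iff)
  have "compact (range g \<times> cball (0::complex) (B + 1) \<times> {\<rho>..1})"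
    by (intro compact_Times compact_range compact_cball compact_Icc)
  with closed have "compact (?K \<inter> (range g \<times> cball (0::complex) (B + 1) \<times> {\<rho>..1}))"
    by (rule closed_Int_compact)
  moreover have "?S = ?K \<inter> (range g \<times> cball (0::complex) (B + 1) \<times> {\<rho>..1})"
  proof (rule set_eqI)
    fix x :: "complex \<times> complex \<times> real"
    obtain p c r where x: "x = (p, c, r)" by (cases x) auto
    have "c \<in> cball 0 (B + 1)" if "p \<in> range g" "dist c p \<le> 1"
      using B[OF that(1)] that(2) norm_triangle_sub[of c p] by (simp add: dist_norm)
    then show "x \<in> ?S \<longleftrightarrow> x \<in> ?K \<inter> (range g \<times> cball (0::complex) (B + 1) \<times> {\<rho>..1})"
      unfolding x ball_subset_interior_iff Ball_def mem_Collect_eq Int_iff mem_Times_iff fst_conv snd_conv case_prod_conv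
        atLeastAtMost_iff by metis
  qed
  ultimately show ?thesis by (simp only:)
qed

text \<open>
  A point \<open>z\<close> inside has a nearest point \<open>g t\<close> on the loop, and the disc around \<open>z\<close> through \<open>g t\<close>
  avoids the loop. By rolling, the discs of radius at most \<open>1\<close> at \<open>g t\<close> on the same side are free of
  nearby points of the loop, and a radius \<open>\<rho>\<close> chosen small once and for all excludes the distant points.
  The nearest points arising in this way are dense in the loop, and compactness carries the discs of
  radius \<open>\<rho>\<close> over to the remaining points.
\<close>

lemma uniform_touching_disc:
  obtains \<rho> where "0 < \<rho>" "\<rho> \<le> 1" "\<And>t. \<exists>c. touching_disc t c \<rho>"
proof -
  obtain \<epsilon> where \<epsilon>: "0 < \<epsilon>" "\<And>t u. dist (g t) (g u) < \<epsilon> \<Longrightarrow> \<exists>u'. g u' = g u \<and> \<bar>u' - t\<bar> \<le> \<delta>"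
    using near_parameter by blast
  define \<rho> where "\<rho> = min 1 (\<epsilon> / 2)"
  have \<rho>: "0 < \<rho>" "\<rho> \<le> 1" "2 * \<rho> \<le> \<epsilon>" using \<epsilon>(1) by (auto simp: \<rho>_def)
  have near: "\<exists>t c. touching_disc t c \<rho> \<and> (\<forall>y\<in>range g. dist z (g t) \<le> dist z y)"
    if z: "z \<in> interior_region" for z
  proof -
    obtain t where t: "\<And>y. y \<in> range g \<Longrightarrow> dist z (g t) \<le> dist z y"
      using distance_attains_inf[OF closed_range, of z] by auto
    define d where "d = dist z (g t)"
    have d: "0 < d" using z range_interior_disjoint[of t] by (auto simp: d_def)
    have empty: "ball z d \<inter> range g = {}" using t by (fastforce simp: d_def)
    then have zd: "ball z d \<subseteq> interior_region"
      using ball_subset_interior_region z d by (meson centre_in_ball disjoint_iff)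
    have dz: "dist z (g t) = d" by (simp add: d_def)
    define B where "B k = ball (g t + k *\<^sub>R (z - g t)) (k * d)" for k
    have mono: "0 < k \<Longrightarrow> k \<le> l \<Longrightarrow> B k \<subseteq> B l" for k l
      unfolding B_def by (rule ball_tangent_mono[OF dz])
    have B1: "B 1 = ball z d" by (simp add: B_def)
    have Bd: "B (1 / d) = ball (g t + (z - g t) /\<^sub>R d) 1" using d by (simp add: B_def divide_inverse)
    define c where "c = g t + (\<rho> / d) *\<^sub>R (z - g t)"
    have Bc: "B (\<rho> / d) = ball c \<rho>" using d by (simp add: B_def c_def)
    have dist: "dist c (g t) = \<rho>" using d \<rho> dz by (simp add: c_def dist_norm)
    have "ball c \<rho> \<inter> range g = {}"
    proof (rule ccontr)
      assume "ball c \<rho> \<inter> range g \<noteq> {}"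
      then obtain u where u: "g u \<in> ball c \<rho>" by auto
      have "dist (g t) (g u) \<le> dist c (g t) + dist c (g u)" by (metis dist_commute dist_triangle)
      then have "dist (g t) (g u) < \<epsilon>" using u dist \<rho> by auto
      then obtain u' where u': "g u' = g u" "\<bar>u' - t\<bar> \<le> \<delta>" using \<epsilon>(2) by blast
      have "B (\<rho> / d) \<subseteq> B (1 / d)" using d \<rho> by (intro mono) (auto simp: field_simps)
      then show False using rolling[OF d dz empty u'(2)] u u'(1) unfolding Bc Bd by auto
    qed
    moreover have "ball c \<rho> \<inter> interior_region \<noteq> {}"
    proof (cases "\<rho> \<le> d")
      case True
      then have "ball c \<rho> \<subseteq> ball z d" using mono[of "\<rho> / d" 1] d \<rho> unfolding B1 Bc by simp
      then show ?thesis using zd \<rho>(1) by (metis centre_in_ball disjoint_iff subsetD)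
    next
      case False
      then have "ball z d \<subseteq> ball c \<rho>" using mono[of 1 "\<rho> / d"] d \<rho> unfolding B1 Bc by simp
      then show ?thesis using z d by (meson centre_in_ball disjoint_iff subsetD)
    qed
    ultimately have "ball c \<rho> \<subseteq> interior_region" by (rule ball_subset_interior_region)
    then show ?thesis using dist \<rho> t unfolding touching_disc_def by blast
  qed
  let ?S = "{(p, c, r). p \<in> range g \<and> \<rho> \<le> r \<and> r \<le> 1 \<and> dist c p = r \<and> ball c r \<subseteq> interior_region}"
  let ?S' = "?S \<inter> UNIV \<times> UNIV \<times> {..\<rho>}"
  have "compact ?S'"
    using compact_touching_balls by (intro compact_Int_closed) (auto intro!: closed_Times)
  then have "closed (fst ` ?S')"
    by (intro compact_imp_closed compact_continuous_image continuous_intros)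
  moreover have "range g \<subseteq> closure (fst ` ?S')"
  proof
    fix p assume p: "p \<in> range g"
    show "p \<in> closure (fst ` ?S')"
      unfolding closure_approachable
    proof (intro allI impI)
      fix e :: real assume "0 < e"
      have "p \<in> closure interior_region" using p frontier_interior_region closure_Un_frontier by blast
      then obtain z where z: "z \<in> interior_region" "dist z p < e / 2"
        unfolding closure_approachable using \<open>0 < e\<close> half_gt_zero by blast
      obtain t c where t: "touching_disc t c \<rho>" "dist z (g t) \<le> dist z p" using near[OF z(1)] p by blast
      have "g t \<in> fst ` ?S'" using t(1) by (intro image_eqI[of _ _ "(g t, c, \<rho>)"]) (auto simp: touching_disc_def)
      moreover have "dist (g t) p < e"
        using z(2) t(2) dist_triangle[of "g t" p z] by (simp add: dist_commute)
      ultimately show "\<exists>y\<in>fst ` ?S'. dist y p < e" by blast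
    qed
  qed
  ultimately have *: "range g \<subseteq> fst ` ?S'" by (simp add: closure_closed)
  have "\<exists>c. touching_disc t c \<rho>" for t
  proof -
    have "g t \<in> fst ` ?S'" using * by blast
    then show ?thesis using \<rho> by (auto simp: touching_disc_def)
  qed
  then show thesis using that \<rho> by blast
qed

text \<open>
  Take the largest disc. If its radius is below \<open>1\<close> and it touches the loop at one point only, then it can
  be enlarged slightly with the same tangent: rolling keeps the nearby points of the loop out, and the
  distant ones stay at a positive distance.
\<close>

lemma unit_or_bitangent_disc:
  obtains (unit) c where "touching_disc t c 1"
  | (bitangent) c r u where "touching_disc t c r" "r < 1" "touching_disc u c r" "g u \<noteq> g t"
proof -
  obtain \<rho> where \<rho>: "0 < \<rho>" "\<rho> \<le> 1" "\<And>t. \<exists>c. touching_disc t c \<rho>" by (rule uniform_touching_disc) blast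
  let ?S = "{(p, c, r). p \<in> range g \<and> \<rho> \<le> r \<and> r \<le> 1 \<and> dist c p = r \<and> ball c r \<subseteq> interior_region}"
  let ?S' = "?S \<inter> {g t} \<times> UNIV"
  have mem: "(g t, c, r) \<in> ?S' \<longleftrightarrow> touching_disc t c r \<and> \<rho> \<le> r" for c r
    using \<rho>(1) by (auto simp: touching_disc_def)
  have cpt: "compact ?S'"
    using compact_touching_balls by (intro compact_Int_closed) (auto intro!: closed_Times)
  obtain c0 where "touching_disc t c0 \<rho>" using \<rho>(3) by blast
  then have ne: "?S' \<noteq> {}" using mem[of c0 \<rho>] by blast
  have "continuous_on ?S' (\<lambda>x. snd (snd x))" by (intro continuous_intros)
  from continuous_attains_sup[OF cpt ne this]
  obtain x where x: "x \<in> ?S'" "\<And>y. y \<in> ?S' \<Longrightarrow> snd (snd y) \<le> snd (snd x)" by blast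
  define c where "c = fst (snd x)"
  define r where "r = snd (snd x)"
  have xeq: "x = (g t, c, r)" using x(1) by (simp add: c_def r_def mem_Times_iff prod_eq_iff)
  have max: "touching_disc t c r" and r\<rho>: "\<rho> \<le> r" using x(1) unfolding xeq mem by blast+
  have maximal: "r' \<le> r" if "touching_disc t c' r'" "\<rho> \<le> r'" for c' r'
  proof -
    have "(g t, c', r') \<in> ?S'" unfolding mem using that by blast
    from x(2)[OF this] show ?thesis by (simp add: xeq)
  qed
  show thesis
  proof (cases "r = 1 \<or> (\<exists>u. g u \<noteq> g t \<and> dist c (g u) = r)")
    case True
    then show thesis using max unit bitangent[of c r] by (fastforce simp: touching_disc_def)
  next
    case False
    then have r: "0 < r" "r < 1" and dist: "dist c (g t) = r" using max by (auto simp: touching_disc_def)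
    have empty: "ball c r \<inter> range g = {}" using touching_disc_avoids[OF max] by blast
    have away: "r < dist c (g u)" if "g u \<noteq> g t" for u
      using False that touching_disc_avoids[OF max, of u] by force
    obtain \<epsilon> where \<epsilon>: "0 < \<epsilon>" "\<And>t u. dist (g t) (g u) < \<epsilon> \<Longrightarrow> \<exists>u'. g u' = g u \<and> \<bar>u' - t\<bar> \<le> \<delta>"
      using near_parameter by blast
    obtain \<eta> where \<eta>: "0 < \<eta>" "\<And>u. \<epsilon> \<le> dist (g t) (g u) \<Longrightarrow> r + \<eta> \<le> dist c (g u)"
    proof (cases "range g - ball (g t) \<epsilon> = {}")
      case True
      then have "g u \<in> ball (g t) \<epsilon>" for u by blast
      then have "dist (g t) (g u) < \<epsilon>" for u by simp
      then show thesis using that[of 1] by (meson not_le zero_less_one)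
    next
      case False
      have "compact (range g - ball (g t) \<epsilon>)" by (intro compact_diff compact_range open_ball)
      then obtain u where u: "g u \<notin> ball (g t) \<epsilon>" "\<And>y. y \<in> range g - ball (g t) \<epsilon> \<Longrightarrow> dist c (g u) \<le> dist c y"
        using continuous_attains_inf[OF _ False, of "dist c"] continuous_on_dist[OF continuous_on_const continuous_on_id]
        by (metis (no_types, lifting) DiffE imageE)
      then have "g u \<noteq> g t" using \<epsilon>(1) by auto
      then show thesis using that[of "dist c (g u) - r"] away u(2) by auto
    qed
    \<comment> \<open>The enlarged disc stays within distance \<open>2 * R - r\<close> of \<open>c\<close>, which is at most \<open>r + \<eta>\<close>.\<close>
    define R where "R = min 1 (r + \<eta> / 2)"
    have R: "r < R" "R \<le> 1" "2 * R - r \<le> r + \<eta>" using r \<eta>(1) by (auto simp: R_def min_def)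
    define B where "B k = ball (g t + k *\<^sub>R (c - g t)) (k * r)" for k
    have mono: "0 < k \<Longrightarrow> k \<le> l \<Longrightarrow> B k \<subseteq> B l" for k l
      unfolding B_def by (rule ball_tangent_mono[OF dist])
    have B1: "B 1 = ball c r" by (simp add: B_def)
    have Br: "B (1 / r) = ball (g t + (c - g t) /\<^sub>R r) 1" using r by (simp add: B_def divide_inverse)
    define c' where "c' = g t + (R / r) *\<^sub>R (c - g t)"
    have Bc: "B (R / r) = ball c' R" using r by (simp add: B_def c'_def)
    have dist': "dist c' (g t) = R" using r R dist by (simp add: c'_def dist_norm)
    have "c - c' = (1 - R / r) *\<^sub>R (c - g t)" by (simp add: c'_def algebra_simps)
    then have "dist c c' = \<bar>1 - R / r\<bar> * r" using dist by (simp add: dist_norm)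
    also have "\<dots> = R - r" using r R by (simp add: field_simps abs_if)
    finally have cc': "dist c c' = R - r" .
    have "ball c' R \<inter> range g = {}"
    proof (rule ccontr)
      assume "ball c' R \<inter> range g \<noteq> {}"
      then obtain u where u: "g u \<in> ball c' R" by auto
      show False
      proof (cases "dist (g t) (g u) < \<epsilon>")
        case True
        then obtain u' where u': "g u' = g u" "\<bar>u' - t\<bar> \<le> \<delta>" using \<epsilon>(2) by blast
        have "B (R / r) \<subseteq> B (1 / r)" using r R by (intro mono) (auto simp: field_simps)
        then show False using rolling[OF r(1) dist empty u'(2)] u u'(1) unfolding Bc Br by auto
      next
        case False
        then show False using \<eta>(2)[of u] u cc' R(3) dist_triangle[of c "g u" c'] by auto
      qed
    qed
    moreover have "ball c r \<subseteq> ball c' R" using mono[of 1 "R / r"] r R unfolding B1 Bc by simp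
    then have "ball c' R \<inter> interior_region \<noteq> {}"
      using max r unfolding touching_disc_def by (meson centre_in_ball disjoint_iff subsetD)
    ultimately have "touching_disc t c' R"
      using ball_subset_interior_region dist' R r by (simp add: touching_disc_def)
    then show thesis using maximal[of c' R] R r\<rho> by simp
  qed
qed

text \<open>
  Apart from the point of tangency, the closed disc lies in the open unit disc with the same tangent at
  \<open>g s\<close>, which contains no nearby point of the loop.
\<close>

lemma bitangent_separation:
  assumes "touching_disc s c r" "touching_disc t c r" "r < 1" "g s \<noteq> g t"
  shows "\<delta> < \<bar>t - s\<bar>"
proof (rule ccontr)
  assume "\<not> \<delta> < \<bar>t - s\<bar>"
  moreover have r: "0 < r" "dist c (g s) = r" "dist c (g t) = r"
    using assms by (auto simp: touching_disc_def)
  moreover have "ball c r \<inter> range g = {}" using touching_disc_avoids[OF assms(1)] by blast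
  ultimately have "g t \<notin> ball (g s + (c - g s) /\<^sub>R r) 1" using rolling[of r c s t] by simp
  moreover have "g t \<in> ball (g s + (1 / r) *\<^sub>R (c - g s)) (1 / r * r)"
    using r assms(3,4) by (intro cball_tangent_strict) auto
  ultimately show False using r by (simp add: divide_inverse)
qed

lemma bitangent_chord_interior:
  assumes "touching_disc s c r" "touching_disc t c r"
  shows "open_segment (g s) (g t) \<subseteq> ball c r" "open_segment (g s) (g t) \<subseteq> interior_region"
  using open_chord_subset_ball[of c "g s" r "g t"] assms by (auto simp: touching_disc_def)

lemma not_in_arc:
  assumes "s \<le> t" "t < m" "m < s + 1"
  shows "g m \<notin> g ` {s..t}"
proof
  assume "g m \<in> g ` {s..t}"
  then obtain u where "s \<le> u" "u \<le> t" "g m = g u" by auto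
  then show False using injective[of m u] assms by auto
qed

text \<open>
  The chords cross, because the chord of the second disc joins the two arcs and therefore cannot stay
  in one cap. At the crossing point both chord estimates for the difference of powers hold, with opposite
  signs, so the difference vanishes there.
\<close>

lemma interleaved_bitangent_discs:
  assumes st: "s < t" "t < s + 1" and D: "touching_disc s c r" "touching_disc t c r"
    and m: "s < m" "m < t" "t < m'" "m' < s + 1" and E: "touching_disc m c' r'" "touching_disc m' c' r'"
  shows "dist c' (g s) = r'"
proof -
  let ?C = "open_segment (g m) (g m')"
  note chord = bitangent_chord_interior[OF D]
  have s1: "g (s + 1) = g s" by (rule periodic)
  have chord': "open_segment (g t) (g (s + 1)) \<subseteq> interior_region"
    using chord(2) by (simp add: s1 open_segment_commute)
  have C: "?C \<subseteq> interior_region" "connected ?C"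
    using bitangent_chord_interior[OF E] by (auto intro: convex_connected)
  have ne: "g m \<noteq> g m'"
  proof
    assume "g m = g m'"
    moreover have "\<bar>m - m'\<bar> < 1" using m by (simp add: abs_if)
    ultimately have "m = m'" by (rule injective)
    then show False using m by simp
  qed
  have "?C \<inter> open_segment (g s) (g t) \<noteq> {}"
  proof
    assume disj: "?C \<inter> open_segment (g s) (g t) = {}"
    have "?C \<inter> cap s t = {}"
      by (rule connected_outside_cap[where p = "g m'", OF st chord(2) C(2,1) disj])
         (use m st in \<open>simp_all add: ne not_in_arc\<close>)
    \<comment> \<open>The arc from \<open>t\<close> to \<open>s + 1\<close> is compared with \<open>m + 1\<close>, which has the same image as \<open>m\<close>.\<close>
    moreover have "g m \<notin> g ` {t..s+1}"
      using not_in_arc[of t "s + 1" "m + 1"] m st by (simp add: periodic)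
    then have "?C \<inter> cap t (s + 1) = {}"
      by (intro connected_outside_cap[where p = "g m", OF _ _ chord' C(2,1)])
         (use st disj in \<open>simp_all add: ne s1 open_segment_commute[of "g t"]\<close>)
    ultimately have "?C = {}" using interior_region_cut_by_chord[OF st chord(2)] C(1) disj by blast
    then show False using ne by simp
  qed
  then obtain x where x: "x \<in> open_segment (g m) (g m')" "x \<in> open_segment (g s) (g t)" by blast
  have DE: "dist c (g s) = r" "dist c (g t) = r" "0 \<le> r" "dist c' (g m) = r'" "dist c' (g m') = r'" "0 \<le> r'"
    using D E by (auto simp: touching_disc_def)
  have "power_difference c r c' r' x \<le> 0"
    using x(2) by (intro power_difference_chord(1)[OF DE(1,2) _ _ DE(6)] touching_disc_avoids[OF E(1)])
      (simp add: open_segment_def)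
  moreover have "power_difference c' r' c r x \<le> 0"
    using x(1) by (intro power_difference_chord(1)[OF DE(4,5) _ _ DE(3)] touching_disc_avoids[OF D(1)])
      (simp add: open_segment_def)
  ultimately have "power_difference c r c' r' x = 0" by (simp add: power_difference_def)
  then show ?thesis
    using power_difference_chord(2)[OF DE(1,2) _ _ DE(6) x(2)] touching_disc_avoids[OF E(1)] by blast
qed

text \<open>
  A point \<open>w\<close> of the second disc outside the first is joined to \<open>g m\<close> by a segment on which the
  difference of powers is positive, except possibly at \<open>g m\<close>. So the segment cannot cross the chord,
  and it stays in the cap at \<open>g m\<close>.
\<close>

lemma touching_disc_subset_cap:
  assumes st: "s < t" "t < s + 1" and D: "touching_disc s c r" "touching_disc t c r"
    and m: "s < m" "m < t" and E: "touching_disc m c' r'"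
  shows "ball c' r' \<subseteq> ball c r \<union> cap s t"
proof
  fix w assume w: "w \<in> ball c' r'"
  note chord = bitangent_chord_interior[OF D]
  have s1: "g (s + 1) = g s" by (rule periodic)
  have chord': "open_segment (g t) (g (s + 1)) \<subseteq> interior_region"
    using chord(2) by (simp add: s1 open_segment_commute)
  have DE: "dist c (g s) = r" "dist c (g t) = r" "0 \<le> r" "dist c' (g m) = r'" "0 \<le> r'" "ball c' r' \<subseteq> interior_region"
    using D E by (auto simp: touching_disc_def)
  show "w \<in> ball c r \<union> cap s t"
  proof (cases "w \<in> ball c r")
    case False
    \<comment> \<open>This is the segment without \<open>g m\<close>, which lies on the circle.\<close>
    let ?C = "ball c' r' \<inter> closed_segment (g m) w"
    have ne: "g m \<noteq> w" using w DE(4) by auto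
    have C: "connected ?C" "?C \<subseteq> interior_region"
      using DE(6) by (auto intro!: convex_connected convex_Int)
    have disj: "?C \<inter> open_segment (g s) (g t) = {}"
    proof (rule ccontr)
      assume "?C \<inter> open_segment (g s) (g t) \<noteq> {}"
      then obtain x where x: "x \<in> ball c' r'" "x \<in> closed_segment (g m) w" "x \<in> open_segment (g s) (g t)" by blast
      from x(2) obtain u where u: "0 \<le> u" "u \<le> 1" "x = (1 - u) *\<^sub>R g m + u *\<^sub>R w" by (auto simp: in_segment)
      have "u \<noteq> 0" using x(1) u(3) DE(4) by auto
      have "r \<le> dist c (g m)" using touching_disc_avoids[OF D(1), of m] by simp
      then have gm: "0 \<le> power_difference c r c' r' (g m)"
        using DE(3,4) by (simp add: power_difference_def)
      have "r\<^sup>2 \<le> (dist c w)\<^sup>2" "(dist c' w)\<^sup>2 < r'\<^sup>2"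
        using False w DE(3,5) by (auto intro: power_mono power_strict_mono)
      then have gw: "0 < power_difference c r c' r' w" by (simp add: power_difference_def)
      have "0 < power_difference c r c' r' x"
        unfolding u(3) power_difference_affine using u \<open>u \<noteq> 0\<close> gm gw by (intro add_nonneg_pos) auto
      moreover have "power_difference c r c' r' x \<le> 0"
        using x(3) by (intro power_difference_chord(1)[OF DE(1,2) _ _ DE(5)] touching_disc_avoids[OF E])
          (simp add: open_segment_def)
      ultimately show False by simp
    qed
    have "open_segment (g m) w \<subseteq> ?C"
    proof
      fix x assume x: "x \<in> open_segment (g m) w"
      have "dist c' x < r'"
        using dist_decreases_open_segment[OF x, of c'] DE(4) w by auto
      then show "x \<in> ?C" using x by (simp add: open_segment_def)
    qed
    then have "closure (open_segment (g m) w) \<subseteq> closure ?C" by (rule closure_mono)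
    then have cl: "g m \<in> closure ?C" using ne by (auto simp: closure_open_segment)
    have "g m \<notin> g ` {t..s+1}"
      using not_in_arc[of t "s + 1" "m + 1"] m st by (simp add: periodic)
    then have "?C \<inter> cap t (s + 1) = {}"
      by (intro connected_outside_cap[where p = "g m", OF _ _ chord' C])
         (use st disj cl in \<open>simp_all add: s1 open_segment_commute[of "g t"]\<close>)
    moreover have "w \<in> ?C" using w by simp
    ultimately have "w \<in> cap s t"
      using C(2) disj interior_region_cut_by_chord[OF st chord(2)] by blast
    then show ?thesis by simp
  qed simp
qed

text \<open>
  Among the discs touching at two parameters \<open>s < t\<close> of the interval, one with \<open>t - s\<close> minimal is
  compared with the largest disc at the midpoint of \<open>s\<close> and \<open>t\<close>. The constraint \<open>s + \<delta> \<le> t\<close> keeps the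
  touching points apart, so that the minimum is attained, and by \<open>bitangent_separation\<close> it excludes
  no disc of radius less than \<open>1\<close>.
\<close>

lemma unit_disc_in_bitangent_arc:
  assumes st0: "s0 < t0" "t0 < s0 + 1" and D0: "touching_disc s0 c0 r0" "touching_disc t0 c0 r0" "r0 < 1"
  obtains m c where "s0 < m" "m < t0" "touching_disc m c 1"
proof -
  let ?S = "{(p, c, r). p \<in> range g \<and> 0 \<le> r \<and> r \<le> 1 \<and> dist c p = r \<and> ball c r \<subseteq> interior_region}"
  define K where "K = {x. s0 \<le> fst (fst x) \<and> snd (fst x) \<le> t0 \<and> fst (fst x) + \<delta> \<le> snd (fst x) \<and>
      (g (fst (fst x)), snd x) \<in> ?S \<and>
      (g (snd (fst x)), snd x) \<in> ?S}"
  have mem: "((s, t), (c, r)) \<in> K \<longleftrightarrow> s0 \<le> s \<and> t \<le> t0 \<and> s + \<delta> \<le> t \<and> touching_disc s c r \<and> touching_disc t c r" for s t c r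
  proof -
    have "0 < r" if "dist c (g s) = r" "dist c (g t) = r" "s0 \<le> s" "t \<le> t0" "s + \<delta> \<le> t"
      using endpoints_distinct[of s t] that st0 \<delta>_pos by (cases "r = 0") auto
    then show ?thesis by (auto simp: touching_disc_def K_def)
  qed
  have cS: "closed ?S" using compact_touching_balls compact_imp_closed by blast
  have cg: "continuous_on UNIV (\<lambda>x. g (f x))" if "continuous_on UNIV f" for f :: "(real \<times> real) \<times> complex \<times> real \<Rightarrow> real"
    by (rule continuous_on_compose2[OF continuous that]) simp
  have vS: "closed {x. f x \<in> ?S}" if "continuous_on UNIV f" for f :: "(real \<times> real) \<times> complex \<times> real \<Rightarrow> _"
    using closed_vimage[OF cS that] unfolding vimage_def .
  have "closed K"
    unfolding K_def by (intro closed_Collect_conj closed_Collect_le vS continuous_intros cg)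
  moreover have "compact (({s0..t0} \<times> {s0..t0}) \<times> snd ` ?S)" (is "compact ?T")
    by (intro compact_Times compact_Icc compact_continuous_image compact_touching_balls continuous_intros)
  ultimately have "compact (K \<inter> ?T)" by (rule closed_Int_compact)
  moreover have "K \<subseteq> ?T"
  proof
    fix x assume x: "x \<in> K"
    then have "snd x \<in> snd ` ?S" by (intro image_eqI[of _ _ "(g (fst (fst x)), snd x)"]) (auto simp: K_def)
    moreover have "fst x \<in> {s0..t0} \<times> {s0..t0}" using x \<delta>_pos by (auto simp: mem_Times_iff K_def)
    ultimately show "x \<in> ?T" by (simp add: mem_Times_iff)
  qed
  ultimately have cpt: "compact K" by (simp only: inf.absorb1)
  have "\<delta> < \<bar>t0 - s0\<bar>"
    using bitangent_separation[OF D0] endpoints_distinct[OF st0] by blast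
  then have "((s0, t0), (c0, r0)) \<in> K" unfolding mem using D0 st0 by simp
  then have ne: "K \<noteq> {}" unfolding ex_in_conv[symmetric] by (rule exI)
  have "continuous_on K (\<lambda>x. snd (fst x) - fst (fst x))"
    by (rule continuous_on_subset[OF _ subset_UNIV]) (intro continuous_intros)
  from continuous_attains_inf[OF cpt ne this]
  obtain x where x: "x \<in> K" "\<forall>y\<in>K. snd (fst x) - fst (fst x) \<le> snd (fst y) - fst (fst y)" by (rule bexE)
  define s t c r where "s = fst (fst x)" and "t = snd (fst x)" and "c = fst (snd x)" and "r = snd (snd x)"
  have xeq: "x = ((s, t), (c, r))" by (simp add: s_def t_def c_def r_def)
  have "((s, t), (c, r)) \<in> K" using x(1) by (simp only: xeq)
  then have K: "s0 \<le> s" "t \<le> t0" "s + \<delta> \<le> t" and D: "touching_disc s c r" "touching_disc t c r"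
    using mem[of s t c r] by blast+
  have minimal: "t - s \<le> t' - s'"
    if "s \<le> s'" "t' \<le> t" "s' < t'" "touching_disc s' c' r'" "touching_disc t' c' r'" "r' < 1" for s' t' c' r'
  proof -
    have "t' < s' + 1" using that(1,2) K(1,2) st0(2) by linarith
    then have "\<delta> < \<bar>t' - s'\<bar>"
      using bitangent_separation[OF that(4-6)] endpoints_distinct[OF that(3)] by blast
    then have "s0 \<le> s' \<and> t' \<le> t0 \<and> s' + \<delta> \<le> t'" using that(1-3) K(1,2) by linarith
    then have "((s', t'), (c', r')) \<in> K" using that(4,5) mem[of s' t' c' r'] by blast
    from bspec[OF x(2) this] show ?thesis by (simp only: xeq fst_conv snd_conv)
  qed
  have st: "s < t" "t < s + 1" using K st0 \<delta>_pos by auto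
  define m where "m = (s + t) / 2"
  have m: "s < m" "m < t" using st by (auto simp: m_def)
  show thesis
  proof (cases rule: unit_or_bitangent_disc[of m])
    case (unit c')
    then show thesis using that[of m] m K by simp
  next
    case (bitangent c' r' u)
    obtain m' where m': "s \<le> m'" "m' < s + 1" "g m' = g u" using representative by blast
    have E': "touching_disc m' c' r'" using bitangent(3) m'(3) by (simp add: touching_disc_def)
    have "m' \<noteq> m" using bitangent(4) m'(3) by auto
    show thesis
    proof (cases "m' \<le> t")
      case True
      then have "t - s \<le> \<bar>m' - m\<bar>"
        using minimal[of m m' c' r'] minimal[of m' m c' r'] \<open>m' \<noteq> m\<close> E' bitangent(1,2) m m'(1)
        by (cases "m < m'") simp_all
      moreover have "\<bar>m' - m\<bar> < t - s" using True m m'(1) by (simp add: abs_if)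
      ultimately show thesis by simp
    next
      case False
      have "dist c' (g s) = r'"
        using interleaved_bitangent_discs[OF st D m _ m'(2) bitangent(1) E'] False by simp
      then have "touching_disc s c' r'" using bitangent(1) by (simp add: touching_disc_def)
      then show thesis using minimal[of s m c' r'] m bitangent(1,2) by simp
    qed
  qed
qed

text \<open>
  If the largest disc at \<open>g a\<close> is a unit disc, then \<open>N\<close> is empty; otherwise it is the cap of the arc
  that avoids \<open>g b\<close>. The last property says that inside the loop the disc at \<open>g a\<close> separates
  \<open>N\<close> from \<open>g b\<close>.
\<close>

lemma unit_disc_near_point:
  assumes far: "4 \<le> dist (g a) (g b)"
  obtains c r p N where "touching_disc a c r" "ball p 1 \<subseteq> interior_region" "ball p 1 \<subseteq> ball c r \<union> N"
    "connected N" "N \<subseteq> interior_region" "N \<noteq> {} \<Longrightarrow> g a \<in> closure N"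
    "\<And>C. connected C \<Longrightarrow> C \<subseteq> interior_region \<Longrightarrow> C \<inter> ball c r = {} \<Longrightarrow> g b \<in> closure C \<Longrightarrow> C \<inter> N = {}"
proof (cases rule: unit_or_bitangent_disc[of a])
  case (unit c)
  then show thesis by (intro that[of c 1 c "{}"]) (auto simp: touching_disc_def)
next
  case (bitangent c r u)
  obtain a' where a': "a \<le> a'" "a' < a + 1" "g a' = g u" using representative by blast
  obtain b' where b': "a \<le> b'" "b' < a + 1" "g b' = g b" using representative by blast
  have D: "touching_disc a c r" "touching_disc a' c r" "touching_disc (a + 1) c r"
    using bitangent a' periodic[of a] by (simp_all add: touching_disc_def)
  have "dist (g a) (g a') \<le> 2"
    using D(1,2) dist_triangle[of "g a" "g a'" c] by (simp add: touching_disc_def dist_commute)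
  then have ne: "b' \<noteq> a'" "b' \<noteq> a" "a' \<noteq> a" using far b'(3) a'(3) bitangent(4) by auto
  obtain s t where st: "s < t" "t < s + 1" "touching_disc s c r" "touching_disc t c r" "g a = g s \<or> g a = g t"
      and b: "g b \<notin> g ` {s..t}"
  proof (cases "a' < b'")
    case True
    show thesis
      by (rule that[of a a']) (use a' b' ne D True not_in_arc[of a a' b'] in auto)
  next
    case False
    have "g (b' + 1) \<notin> g ` {a'..a+1}" using not_in_arc[of a' "a + 1" "b' + 1"] False a' b' ne by auto
    then show thesis
      by (intro that[of a' "a + 1"]) (use a' b' ne D False periodic in auto)
  qed
  note chord = bitangent_chord_interior[OF st(3,4)]
  note J = cap_Jordan[OF st(1,2) chord(2)]
  obtain m p where m: "s < m" "m < t" "touching_disc m p 1"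
    using unit_disc_in_bitangent_arc[OF st(1-4) bitangent(2)] by blast
  show thesis
  proof (rule that[of c r p "cap s t"])
    show "touching_disc a c r" by (rule D)
    show "ball p 1 \<subseteq> interior_region" using m(3) by (simp add: touching_disc_def)
    show "ball p 1 \<subseteq> ball c r \<union> cap s t" by (rule touching_disc_subset_cap[OF st(1-4) m])
    show "connected (cap s t)" by (rule J(1))
    show "cap s t \<subseteq> interior_region" by (rule cap_subset_interior[OF st(1,2) chord(2)])
    show "g a \<in> closure (cap s t)" using st(1,5) by (auto simp: closure_Un_frontier J(2))
    show "C \<inter> cap s t = {}"
      if "connected C" "C \<subseteq> interior_region" "C \<inter> ball c r = {}" "g b \<in> closure C" for C
      using connected_outside_cap[OF st(1,2) chord(2) that(1,2) _ that(4) _ b] that(3) chord(1) by blast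
  qed
qed

lemma two_disjoint_unit_discs:
  assumes far: "4 \<le> dist (g a) (g b)"
  shows "\<exists>p q. disjnt (ball p 1) (ball q 1) \<and> ball p 1 \<subseteq> interior_region \<and> ball q 1 \<subseteq> interior_region"
proof -
  obtain c r p N where A: "touching_disc a c r" "ball p 1 \<subseteq> interior_region" "ball p 1 \<subseteq> ball c r \<union> N"
    "connected N" "N \<subseteq> interior_region" "N \<noteq> {} \<Longrightarrow> g a \<in> closure N"
    "\<And>C. connected C \<Longrightarrow> C \<subseteq> interior_region \<Longrightarrow> C \<inter> ball c r = {} \<Longrightarrow> g b \<in> closure C \<Longrightarrow> C \<inter> N = {}"
    using unit_disc_near_point[OF far] by blast
  have far': "4 \<le> dist (g b) (g a)" using far by (simp add: dist_commute)
  obtain c' r' p' N' where B: "touching_disc b c' r'" "ball p' 1 \<subseteq> interior_region" "ball p' 1 \<subseteq> ball c' r' \<union> N'"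
    "connected N'" "N' \<subseteq> interior_region" "N' \<noteq> {} \<Longrightarrow> g b \<in> closure N'"
    "\<And>C. connected C \<Longrightarrow> C \<subseteq> interior_region \<Longrightarrow> C \<inter> ball c' r' = {} \<Longrightarrow> g a \<in> closure C \<Longrightarrow> C \<inter> N' = {}"
    using unit_disc_near_point[OF far'] by blast
  have D: "0 < r" "r \<le> 1" "dist c (g a) = r" "ball c r \<subseteq> interior_region"
    and D': "0 < r'" "r' \<le> 1" "dist c' (g b) = r'" "ball c' r' \<subseteq> interior_region"
    using A(1) B(1) by (auto simp: touching_disc_def)
  have DD': "ball c r \<inter> ball c' r' = {}"
  proof (rule disjoint_ballI)
    show "r + r' \<le> dist c c'"
      using far D D' dist_triangle[of "g a" "g b" c] dist_triangle[of c "g b" c'] by (simp add: dist_commute)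
  qed
  have cl: "g a \<in> closure (ball c r)" "g b \<in> closure (ball c' r')"
    using D D' by (simp_all add: closure_ball)
  have DN': "ball c r \<inter> N' = {}" using B(7)[OF connected_ball D(4) DD' cl(1)] .
  have D'N: "ball c' r' \<inter> N = {}" using A(7)[OF connected_ball D'(4) _ cl(2)] DD' by blast
  have "N \<inter> N' = {}"
  proof (cases "N = {}")
    case False
    then show ?thesis using B(7)[OF A(4,5) _ A(6)[OF False]] D'N by blast
  qed simp
  then have "ball p 1 \<inter> ball p' 1 = {}" using A(3) B(3) DD' DN' D'N by blast
  then show ?thesis using A(2) B(2) unfolding disjnt_def by blast
qed

end

section \<open>Two disjoint unit discs\<close>

text \<open>
  An isometry maps the component of \<open>x\<close> in the complement of \<open>S\<close> into that of \<open>f x\<close>, so boundedness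
  of the latter carries over to the former. This transfers the result from the complex plane to \<open>real^2\<close>.
\<close>

lemma isometry_reflects_inside:
  fixes f :: "'a::real_normed_vector \<Rightarrow> 'b::real_normed_vector"
  assumes iso: "\<And>x y. dist (f x) (f y) = dist x y" and x: "f x \<in> inside (f ` S)"
  shows "x \<in> inside S"
proof -
  let ?C = "connected_component_set (- S) x"
  have inj: "f u = f v \<longleftrightarrow> u = v" for u v
    using dist_eq_0_iff[of "f u" "f v"] dist_eq_0_iff[of u v] iso[of u v] by simp
  have "f x \<notin> f ` S" using x inside_no_overlap[of "f ` S"] by blast
  then have xS: "x \<notin> S" by blast
  have "continuous_on ?C f"
    by (auto simp: continuous_on_iff iso)
  then have "connected (f ` ?C)" by (intro connected_continuous_image) auto
  moreover have "f ` ?C \<subseteq> - (f ` S)"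
  proof
    fix z assume "z \<in> f ` ?C"
    then obtain y where y: "z = f y" "y \<in> ?C" by blast
    then have "y \<notin> S" using connected_component_subset[of "- S" x] by blast
    then show "z \<in> - (f ` S)" using y(1) inj by auto
  qed
  moreover have "f x \<in> f ` ?C" using xS by simp
  ultimately have "f ` ?C \<subseteq> connected_component_set (- (f ` S)) (f x)"
    by (intro connected_component_maximal)
  moreover have "bounded (connected_component_set (- (f ` S)) (f x))"
    using x by (simp add: inside_def)
  ultimately have "bounded (f ` ?C)" by (metis bounded_subset)
  then obtain e where "\<forall>z\<in>f ` ?C. dist (f x) z \<le> e"
    unfolding bounded_any_center[of "f ` ?C" "f x"] by blast
  then have "\<forall>y\<in>?C. dist x y \<le> e" by (simp only: ball_simps iso)
  then have "bounded ?C" unfolding bounded_def by blast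
  then show ?thesis using xS by (simp add: inside_def)
qed

lemma simple_periodic_injective:
  assumes per: "\<And>t. f (t + 1) = f t" and "loop_free f" and eq: "f u = f v" and less: "\<bar>u - v\<bar> < 1"
  shows "u = v"
proof -
  have fr: "f (frac x) = f x" for x
    using periodic_int[of f x "- \<lfloor>x\<rfloor>", OF per] by (simp add: frac_def)
  have range: "frac x \<in> {0..1}" "frac x \<noteq> 1" for x :: real
    using frac_lt_1[of x] by auto
  have "f (frac u) = f (frac v)" using eq by (simp only: fr)
  then have "frac u = frac v"
    using \<open>loop_free f\<close> range[of u] range[of v] unfolding loop_free_def by blast
  then have uv: "u - v = of_int (\<lfloor>u\<rfloor> - \<lfloor>v\<rfloor>)" by (simp add: frac_def)
  then have "\<bar>\<lfloor>u\<rfloor> - \<lfloor>v\<rfloor>\<bar> < 1" using less by linarith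
  then show ?thesis using uv by simp
qed

theorem theorem1:
  fixes \<gamma> :: "real \<Rightarrow> real^2"
  assumes "simple_closed_plane_curve \<gamma>"
    and "\<And>t. curvature \<gamma> t \<le> 1"
    and "diameter (path_image \<gamma>) \<ge> 4"
  shows "\<exists>p q. disjnt (ball p 1) (ball q 1) \<and>
           ball p 1 \<subseteq> inside (path_image \<gamma>) \<and> ball q 1 \<subseteq> inside (path_image \<gamma>)"
proof -
  have reg: "regular_closed_C2_curve \<gamma>" and simple: "simple_path \<gamma>"
    using assms(1) by (auto simp: simple_closed_plane_curve_def)
  have per: "\<gamma> (t + 1) = \<gamma> t" for t using reg by (simp add: regular_closed_C2_curve_def)
  have cont: "continuous_on UNIV \<gamma>"
    using reg C1_differentiable_imp_continuous_on by (auto simp: regular_closed_C2_curve_def)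
  have range: "range \<gamma> = path_image \<gamma>"
  proof
    show "range \<gamma> \<subseteq> path_image \<gamma>"
    proof
      fix p assume "p \<in> range \<gamma>"
      then obtain x where x: "p = \<gamma> x" by auto
      obtain u where "0 \<le> u" "u < 0 + 1" "\<gamma> u = \<gamma> x" using periodic_representative[of \<gamma> 0 x] per by blast
      then show "p \<in> path_image \<gamma>" unfolding x path_image_def by (intro image_eqI[of _ _ u]) auto
    qed
  qed (auto simp: path_image_def)
  obtain \<delta> where \<delta>: "0 < \<delta>"
    "\<And>t u c r. 0 < r \<Longrightarrow> dist c (\<gamma> t) = r \<Longrightarrow> ball c r \<inter> range \<gamma> = {} \<Longrightarrow> \<bar>u - t\<bar> \<le> \<delta>
       \<Longrightarrow> \<gamma> u \<notin> ball (\<gamma> t + (c - \<gamma> t) /\<^sub>R r) 1"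
    using curvature_at_most_one_rolling[OF reg assms(2)] by blast
  define f :: "real^2 \<Rightarrow> complex" where "f x = Complex (x $ 1) (x $ 2)" for x
  have lin: "f (x + y) = f x + f y" "f (x - y) = f x - f y" "f (k *\<^sub>R x) = k *\<^sub>R f x" for x y k
    by (simp_all add: f_def complex_eq_iff)
  have iso: "dist (f x) (f y) = dist x y" for x y
    by (simp add: dist_norm lin(2)[symmetric])
       (simp add: f_def cmod_def norm_vec_def L2_set_def sum_2)
  have surj: "\<exists>x. f x = z" for z
    by (rule exI[of _ "vector [Re z, Im z]"]) (simp add: f_def)
  have preimage_ball: "f x \<in> ball (f y) r \<longleftrightarrow> x \<in> ball y r" for x y r
    by (simp add: iso)
  interpret rolling_loop "f \<circ> \<gamma>" \<delta>
  proof
    show "continuous_on UNIV (f \<circ> \<gamma>)"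
      by (intro continuous_on_compose cont) (auto simp: continuous_on_iff iso)
    show "0 < \<delta>" by (rule \<delta>)
  next
    fix t
    show "(f \<circ> \<gamma>) (t + 1) = (f \<circ> \<gamma>) t" by (simp add: per)
  next
    fix u v assume "(f \<circ> \<gamma>) u = (f \<circ> \<gamma>) v" and less: "\<bar>u - v\<bar> < 1"
    then have "\<gamma> u = \<gamma> v" using iso[of "\<gamma> u" "\<gamma> v"] by simp
    then show "u = v"
      using simple_periodic_injective[of \<gamma> u v, OF per _ _ less] simple by (simp add: simple_path_def)
  next
    fix r c t u
    assume r: "0 < r" and dist: "dist c ((f \<circ> \<gamma>) t) = r" and empty: "ball c r \<inter> range (f \<circ> \<gamma>) = {}"
      and u: "\<bar>u - t\<bar> \<le> \<delta>"
    obtain c' where c': "c = f c'" using surj by metis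
    have "(f \<circ> \<gamma>) v \<notin> ball c r" for v using empty by blast
    then have "ball c' r \<inter> range \<gamma> = {}" by (auto simp: c' iso)
    moreover have "dist c' (\<gamma> t) = r" using dist by (simp add: c' iso)
    ultimately have "\<gamma> u \<notin> ball (\<gamma> t + (c' - \<gamma> t) /\<^sub>R r) 1" using \<delta>(2) r u by blast
    then have "f (\<gamma> u) \<notin> ball (f (\<gamma> t + (c' - \<gamma> t) /\<^sub>R r)) 1" unfolding preimage_ball .
    then show "(f \<circ> \<gamma>) u \<notin> ball ((f \<circ> \<gamma>) t + (c - (f \<circ> \<gamma>) t) /\<^sub>R r) 1"
      unfolding o_apply lin c' .
  qed
  have "compact (path_image \<gamma>)" using simple compact_simple_path_image by blast
  then obtain x y where "x \<in> path_image \<gamma>" "y \<in> path_image \<gamma>" "dist x y = diameter (path_image \<gamma>)"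
    using diameter_compact_attained[of "path_image \<gamma>"] path_image_nonempty by blast
  then obtain a b where "dist (\<gamma> a) (\<gamma> b) = diameter (path_image \<gamma>)" by (auto simp: path_image_def)
  then have "4 \<le> dist ((f \<circ> \<gamma>) a) ((f \<circ> \<gamma>) b)" using assms(3) by (simp add: iso)
  then obtain P Q where PQ: "disjnt (ball P 1) (ball Q 1)"
      "ball P 1 \<subseteq> interior_region" "ball Q 1 \<subseteq> interior_region"
    using two_disjoint_unit_discs by blast
  obtain p q where pq: "P = f p" "Q = f q" using surj by metis
  have transport: "ball z 1 \<subseteq> inside (path_image \<gamma>)" if "ball (f z) 1 \<subseteq> interior_region" for z
  proof
    fix w assume "w \<in> ball z 1"
    then have "f w \<in> interior_region" using that preimage_ball by blast
    moreover have "range (f \<circ> \<gamma>) = f ` path_image \<gamma>" by (simp only: image_comp[symmetric] range)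
    ultimately have "f w \<in> inside (f ` path_image \<gamma>)" by (simp only:)
    then show "w \<in> inside (path_image \<gamma>)" using isometry_reflects_inside[of f, OF iso] by blast
  qed
  have "disjnt (ball p 1) (ball q 1)"
    using PQ(1) preimage_ball unfolding pq disjnt_iff by blast
  then show ?thesis using transport PQ(2,3) unfolding pq by blast
qed


end
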